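(* Let $q\geq 3$ be an integer and $p\in(0,1)$, let $Z_n=(\eta_n,X_n)$, $n\ge 0$, be the lamplighter random walk on $\mathcal{L}_q=(\mathbb{Z}/2)\wr\mathcal{T}_q$ described in the context, and let $\ell=\lim_{n\to\infty}\ell(Z_n)/n$ be its rate of escape. Then $$\ell>\lim_{n\to\infty}\frac{|X_n|}{n},$$ that is, the random walk on $\mathcal{L}_q$ escapes to infinity strictly faster than its projection $(X_n)$ onto the tree $\mathcal{T}_q$.
   Context: Let $\mathcal{S}=\{a_1,\dots,a_q\}$ and let $\mathcal{T}_q$ be the free product of $q$ copies of $\mathbb{Z}/2$ generated by the $a_i$ (so $a_i^{-1}=a_i$); its elements are the finite words over $\mathcal{S}$ with no two equal consecutive letters, the identity is the empty word $o$, and its Cayley graph with respect to $\mathcal{S}$ is the homogeneous tree of degree $q$. $|x|$ denotes the distance of $x$ to $o$ in this tree (the word length). $\mathcal{N}$ is the set of finitely supported functions $\eta:\mathcal{T}_q\to\mathbb{Z}/2=\{0,1\}$ (lamp configurations), $\mathbf{0}$ is the zero function, $\mathbf{1}_o$ is the indicator function of $\{o\}$, and $(x\eta)(w):=\eta(x^{-1}w)$. The group $\mathcal{L}_q=(\mathbb{Z}/2)\wr\mathcal{T}_q$ is the set $\mathcal{N}\times\mathcal{T}_q$ with the product $(\eta_1,x)(\eta_2,y)=(\eta_1\oplus x\eta_2,\,xy)$, where $\oplus$ is pointwise addition mod 2; its identity is $(\mathbf{0},o)$. Let $\mathcal{S}_{\mathcal{L}_q}=\{(\mathbf{1}_o,o)\}\cup\{(\mathbf{0},a):a\in\mathcal{S}\}$.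 For $(\eta,x)\in\mathcal{L}_q$, $\ell((\eta,x))$ is the length of a shortest path from $(\eta,x)$ to $(\mathbf{0},o)$ in the Cayley graph of $\mathcal{L}_q$ with respect to $\mathcal{S}_{\mathcal{L}_q}$ (edges $g\sim gs$). Random walk: $\mathbf{i}_1,\mathbf{i}_2,\dots$ are i.i.d. $\mathcal{L}_q$-valued with law $\mu$, where $\mu((\mathbf{1}_o,o))=p$ and $\mu((\mathbf{0},a))=(1-p)/q$ for each $a\in\mathcal{S}$; $Z_0=(\mathbf{0},o)$ and $Z_n=Z_{n-1}\mathbf{i}_n$. Write $Z_n=(\eta_n,X_n)$. The rate of escape $\ell=\lim_{n\to\infty}\ell(Z_n)/n$ exists almost surely and is almost surely constant (Kingman's subadditive ergodic theorem); $\lim_{n\to\infty}|X_n|/n$ likewise denotes the almost sure constant limit. *)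

theory Defs
  imports "HOL-Probability.Probability" "HOL-Algebra.Group" "HOL-Library.Z2"
begin

definition cayley_edges :: "('g, 'b) monoid_scheme \<Rightarrow> 'g set \<Rightarrow> ('g \<times> 'g) set" where
  "cayley_edges G S = {(g, h). g \<in> carrier G \<and> h \<in> carrier G \<and>
     (\<exists>s\<in>S. h = g \<otimes>\<^bsub>G\<^esub> s \<or> g = h \<otimes>\<^bsub>G\<^esub> s)}"

definition cayley_dist :: "('g, 'b) monoid_scheme \<Rightarrow> 'g set \<Rightarrow> 'g \<Rightarrow> 'g \<Rightarrow> nat" where
  "cayley_dist G S g h = (LEAST n. (g, h) \<in> cayley_edges G S ^^ n)"

primrec random_walk :: "('g, 'b) monoid_scheme \<Rightarrow> (nat \<Rightarrow> 'w \<Rightarrow> 'g) \<Rightarrow> nat \<Rightarrow> 'w \<Rightarrow> 'g" where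
  "random_walk G \<xi> 0 \<omega> = \<one>\<^bsub>G\<^esub>"
| "random_walk G \<xi> (Suc n) \<omega> = random_walk G \<xi> n \<omega> \<otimes>\<^bsub>G\<^esub> \<xi> (Suc n) \<omega>"

text \<open>
  The letters are the numbers below \<open>q\<close>. Elements are the words without two equal consecutive
  letters; a product is the concatenation, reduced by deleting pairs of equal neighbours
  (each generator is its own inverse).
\<close>

type_synonym word = "nat list"

fun push_letter :: "nat \<Rightarrow> word \<Rightarrow> word" where
  "push_letter a [] = [a]"
| "push_letter a (b # w) = (if a = b then w else a # b # w)"

definition tree_group :: "nat \<Rightarrow> word monoid" where
  "tree_group q = \<lparr>carrier = {w. set w \<subseteq> {..<q} \<and> distinct_adj w},
                   mult = foldr push_letter, one = []\<rparr>"

definition tree_gens :: "nat \<Rightarrow> word set" where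
  "tree_gens q = {[a] | a. a < q}"

definition tree_length :: "nat \<Rightarrow> word \<Rightarrow> nat" where
  "tree_length q x = cayley_dist (tree_group q) (tree_gens q) x \<one>\<^bsub>tree_group q\<^esub>"

type_synonym config = "word \<Rightarrow> bit"

text \<open>Functions on the tree are represented by functions on all words that vanish off the tree.\<close>

definition configs :: "nat \<Rightarrow> config set" where
  "configs q = {\<eta>. finite {w. \<eta> w \<noteq> 0} \<and> {w. \<eta> w \<noteq> 0} \<subseteq> carrier (tree_group q)}"

definition translate :: "nat \<Rightarrow> word \<Rightarrow> config \<Rightarrow> config" where
  "translate q x \<eta> = (\<lambda>w. if w \<in> carrier (tree_group q)
     then \<eta> (inv\<^bsub>tree_group q\<^esub> x \<otimes>\<^bsub>tree_group q\<^esub> w) else 0)"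

definition lamplighter_group :: "nat \<Rightarrow> (config \<times> word) monoid" where
  "lamplighter_group q =
    \<lparr>carrier = configs q \<times> carrier (tree_group q),
     mult = (\<lambda>(\<eta>\<^sub>1, x) (\<eta>\<^sub>2, y). (\<lambda>w. \<eta>\<^sub>1 w + translate q x \<eta>\<^sub>2 w, x \<otimes>\<^bsub>tree_group q\<^esub> y)),
     one = (\<lambda>_. 0, \<one>\<^bsub>tree_group q\<^esub>)\<rparr>"

definition switch_gen :: "config \<times> word" where
  "switch_gen = (\<lambda>w. if w = [] then 1 else 0, [])"

definition move_gen :: "nat \<Rightarrow> config \<times> word" where
  "move_gen a = (\<lambda>_. 0, [a])"

definition lamplighter_gens :: "nat \<Rightarrow> (config \<times> word) set" where
  "lamplighter_gens q = insert switch_gen {move_gen a | a. a < q}"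

definition lamplighter_length :: "nat \<Rightarrow> config \<times> word \<Rightarrow> nat" where
  "lamplighter_length q g =
     cayley_dist (lamplighter_group q) (lamplighter_gens q) g \<one>\<^bsub>lamplighter_group q\<^esub>"

definition step_law :: "nat \<Rightarrow> real \<Rightarrow> config \<times> word \<Rightarrow> real" where
  "step_law q p g =
    (if g = switch_gen then p
     else if \<exists>a<q. g = move_gen a then (1 - p) / real q
     else 0)"

lemma push_letter_carrier:
  "a < q \<Longrightarrow> w \<in> carrier (tree_group q) \<Longrightarrow> push_letter a w \<in> carrier (tree_group q)"
  by (cases w) (auto simp: tree_group_def distinct_adj_Cons split: list.splits)

lemma push_letter_twice: "distinct_adj w \<Longrightarrow> push_letter a (push_letter a w) = w"
  by (cases w; cases "tl w") auto

lemma foldr_push_letter_carrier: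
  "set u \<subseteq> {..<q} \<Longrightarrow> w \<in> carrier (tree_group q) \<Longrightarrow>
   foldr push_letter u w \<in> carrier (tree_group q)"
  by (induction u) (auto intro: push_letter_carrier)

lemma foldr_push_letter_push_letter:
  assumes "distinct_adj w"
  shows "foldr push_letter (push_letter a v) w = push_letter a (foldr push_letter v w)"
proof -
  have *: "distinct_adj (foldr push_letter u w)" for u
  proof (induction u)
    case (Cons b u)
    then show ?case
      by (cases "foldr push_letter u w") (auto simp: distinct_adj_Cons split: list.splits)
  qed (use assms in simp)
  show ?thesis
    by (cases v) (auto simp: push_letter_twice *)
qed

lemma foldr_push_letter_Nil: "distinct_adj u \<Longrightarrow> foldr push_letter u [] = u"
proof (induction u)
  case (Cons a u)
  then show ?case by (cases u) auto
qed simp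

lemma foldr_push_letter_assoc:
  "distinct_adj w \<Longrightarrow>
   foldr push_letter (foldr push_letter u v) w = foldr push_letter u (foldr push_letter v w)"
  by (induction u) (auto simp: foldr_push_letter_push_letter)

lemma foldr_push_letter_rev:
  assumes "distinct_adj w"
  shows "foldr push_letter (rev w) w = []"
  using assms
proof (induction w)
  case (Cons a w)
  then show ?case by (cases w) auto
qed simp

lemma group_tree_group: "group (tree_group q)"
proof (rule groupI)
  fix x assume x: "x \<in> carrier (tree_group q)"
  have "rev x \<in> carrier (tree_group q)" "foldr push_letter (rev x) x = []"
    using x by (auto simp: tree_group_def foldr_push_letter_rev)
  moreover from this(2) have "rev x \<otimes>\<^bsub>tree_group q\<^esub> x = \<one>\<^bsub>tree_group q\<^esub>"
    by (simp add: tree_group_def)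
  ultimately show "\<exists>y\<in>carrier (tree_group q). y \<otimes>\<^bsub>tree_group q\<^esub> x = \<one>\<^bsub>tree_group q\<^esub>"
    by blast
next
  fix x y assume "x \<in> carrier (tree_group q)" "y \<in> carrier (tree_group q)"
  then show "x \<otimes>\<^bsub>tree_group q\<^esub> y \<in> carrier (tree_group q)"
    using foldr_push_letter_carrier[of x q y] by (simp add: tree_group_def)
qed (auto simp: tree_group_def foldr_push_letter_assoc)

lemma translate_one:
  assumes "\<eta> \<in> configs q"
  shows "translate q \<one>\<^bsub>tree_group q\<^esub> \<eta> = \<eta>"
proof
  interpret T: group "tree_group q" by (rule group_tree_group)
  fix w
  have "\<eta> w = 0" if "w \<notin> carrier (tree_group q)"
    using assms that unfolding configs_def by blast
  then show "translate q \<one>\<^bsub>tree_group q\<^esub> \<eta> w = \<eta> w"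
    by (simp add: translate_def)
qed

lemma translate_mult:
  assumes "x \<in> carrier (tree_group q)" "y \<in> carrier (tree_group q)"
  shows "translate q (x \<otimes>\<^bsub>tree_group q\<^esub> y) \<eta> = translate q x (translate q y \<eta>)"
proof -
  interpret T: group "tree_group q" by (rule group_tree_group)
  show ?thesis
    using assms by (auto simp: translate_def fun_eq_iff T.inv_mult_group T.m_assoc)
qed

lemma translate_add:
  "translate q x (\<lambda>w. \<eta> w + \<theta> w) = (\<lambda>w. translate q x \<eta> w + translate q x \<theta> w)"
  by (auto simp: translate_def)

lemma translate_zero: "translate q x (\<lambda>_. 0) = (\<lambda>_. 0)"
  by (auto simp: translate_def)

lemma translate_configs:
  assumes x: "x \<in> carrier (tree_group q)" and \<eta>: "\<eta> \<in> configs q"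
  shows "translate q x \<eta> \<in> configs q"
proof -
  interpret T: group "tree_group q" by (rule group_tree_group)
  have "{w. translate q x \<eta> w \<noteq> 0} \<subseteq> (\<lambda>v. x \<otimes>\<^bsub>tree_group q\<^esub> v) ` {w. \<eta> w \<noteq> 0}"
  proof
    fix w assume "w \<in> {w. translate q x \<eta> w \<noteq> 0}"
    then have "w \<in> carrier (tree_group q)" "\<eta> (inv\<^bsub>tree_group q\<^esub> x \<otimes>\<^bsub>tree_group q\<^esub> w) \<noteq> 0"
      by (auto simp: translate_def split: if_splits)
    moreover from this x
    have "w = x \<otimes>\<^bsub>tree_group q\<^esub> (inv\<^bsub>tree_group q\<^esub> x \<otimes>\<^bsub>tree_group q\<^esub> w)"
      by (simp add: T.m_assoc[symmetric])
    ultimately show "w \<in> (\<lambda>v. x \<otimes>\<^bsub>tree_group q\<^esub> v) ` {w. \<eta> w \<noteq> 0}"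
      by blast
  qed
  then have "finite {w. translate q x \<eta> w \<noteq> 0}"
    using \<eta> by (auto simp: configs_def intro: finite_subset)
  then show ?thesis
    by (auto simp: configs_def translate_def)
qed

lemma add_configs:
  assumes "\<eta> \<in> configs q" "\<theta> \<in> configs q"
  shows "(\<lambda>w. \<eta> w + \<theta> w) \<in> configs q"
proof -
  have "{w. \<eta> w + \<theta> w \<noteq> 0} \<subseteq> {w. \<eta> w \<noteq> 0} \<union> {w. \<theta> w \<noteq> 0}"
    by auto
  then show ?thesis
    using assms by (auto simp: configs_def intro: finite_subset)
qed

lemma zero_configs: "(\<lambda>_. 0) \<in> configs q"
  by (simp add: configs_def)

lemma group_lamplighter_group: "group (lamplighter_group q)"
proof -
  interpret T: group "tree_group q" by (rule group_tree_group)
  show ?thesis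
  proof (rule groupI)
    fix g assume "g \<in> carrier (lamplighter_group q)"
    then obtain \<eta> x where g: "g = (\<eta>, x)" "\<eta> \<in> configs q" "x \<in> carrier (tree_group q)"
      by (auto simp: lamplighter_group_def)
    let ?x = "inv\<^bsub>tree_group q\<^esub> x"
    have "(translate q ?x \<eta>, ?x) \<in> carrier (lamplighter_group q)"
      using g by (auto simp: lamplighter_group_def translate_configs)
    moreover have "(translate q ?x \<eta>, ?x) \<otimes>\<^bsub>lamplighter_group q\<^esub> g = \<one>\<^bsub>lamplighter_group q\<^esub>"
      using g by (auto simp: lamplighter_group_def)
    ultimately show "\<exists>h\<in>carrier (lamplighter_group q).
        h \<otimes>\<^bsub>lamplighter_group q\<^esub> g = \<one>\<^bsub>lamplighter_group q\<^esub>"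
      by blast
  qed (auto simp: lamplighter_group_def add_configs translate_configs zero_configs translate_one
      translate_mult translate_add T.m_assoc add.assoc simp del: add_bit_eq_xor)
qed

end

theory Submission
  imports Defs
begin

text \<open>
  Both limits are instances of one subadditive theorem for walks with independent identically
  distributed increments on a countable group (\<open>rate_exists\<close>), applied to the lamplighter length
  and to the word length of the tree component. Its proof has three ingredients. Multiplying by a
  fixed element on the left changes a subadditive length by a bounded amount, so the lower rate
  \<open>liminf L(Z_n) / n\<close> is a tail variable and, by the zero-one law of Kolmogorov, a constant \<open>c\<close>.
  By the definition of \<open>c\<close>, most starting times begin a stretch of at most \<open>K\<close> increments whose
  length is at most \<open>c + \<epsilon>\<close> per step, for a suitable \<open>K\<close>. Covering \<open>{0..<n}\<close>
  greedily by such stretches gives \<open>E L(Z_n) \<le> n (c + 2 \<epsilon>) + K\<close>. Finally, cutting time into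
  blocks of a fixed size \<open>m\<close> and applying the inequality of Hoeffding to the independent block
  lengths bounds the limit superior by \<open>E L(Z_m) / m\<close> for each \<open>m\<close>, hence by \<open>c\<close>.

  For the strict inequality, a word in the generators that represents \<open>(\<eta>, x)\<close> has to walk from the
  identity to \<open>x\<close> and has to switch every lamp of \<open>\<eta>\<close>, so the lamplighter length is at least
  \<open>|x|\<close> plus the number of lamps that are on. It remains to see that this number grows linearly in
  expectation. A step changes it only if it is a switch, and then by the sign of the lamp at the
  current position: \<open>+1\<close> if the lamp is off and \<open>-1\<close> if it is on. With
  \<open>H_n(w) = E (-1)^{\<eta>_n(X_n w)}\<close>, the mean sign of the lamp at relative position \<open>w\<close>, the expected
  increase is therefore \<open>p H_n(o)\<close>. Conditioning on the last step shows that \<open>H_n\<close> solves the linear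
  recursion \<open>lamp_sign_mean_Suc\<close>, which is the transition operator of the walk on the tree with
  the sign of the switching term reversed at the root. Because \<open>q \<ge> 3\<close>, this operator has the
  explicit fixed function \<open>1 - c (q - 1)^{-|w|}\<close> with a constant \<open>0 < c < 1\<close>, and
  \<open>H_n\<close> converges to it geometrically, since \<open>(2/3)^{|w|}\<close> is contracted by a
  factor below one (\<open>lamp_sign_mean_approx\<close>). So
  \<open>H_n(o) \<rightarrow> 1 - c > 0\<close>, and the two rates differ by at least \<open>p (1 - c)\<close>.
\<close>

section \<open>Partial products in a group\<close>

primrec partial_product :: "('g, 'b) monoid_scheme \<Rightarrow> (nat \<Rightarrow> 'g) \<Rightarrow> nat \<Rightarrow> 'g" where
  "partial_product G s 0 = \<one>\<^bsub>G\<^esub>"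
| "partial_product G s (Suc n) = partial_product G s n \<otimes>\<^bsub>G\<^esub> s n"

lemma partial_product_cong:
  "(\<And>i. i < n \<Longrightarrow> s i = t i) \<Longrightarrow> partial_product G s n = partial_product G t n"
  by (induction n) auto

lemma (in monoid) partial_product_closed:
  "(\<And>i. i < n \<Longrightarrow> s i \<in> carrier G) \<Longrightarrow> partial_product G s n \<in> carrier G"
  by (induction n) auto

lemma (in monoid) partial_product_add:
  assumes "\<And>i. s i \<in> carrier G"
  shows "partial_product G s (m + n) =
    partial_product G s m \<otimes> partial_product G (\<lambda>i. s (m + i)) n"
  using assms by (induction n) (auto simp: partial_product_closed m_assoc)

lemma (in monoid) measurable_partial_product:
  assumes countable: "countable (carrier G)"
    and f: "\<And>i. i < n \<Longrightarrow> f i \<in> N \<rightarrow>\<^sub>M count_space (carrier G)"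
  shows "(\<lambda>x. partial_product G (\<lambda>i. f i x) n) \<in> N \<rightarrow>\<^sub>M count_space (carrier G)"
  using f
proof (induction n)
  case (Suc n)
  have "(\<lambda>x. (partial_product G (\<lambda>i. f i x) n, f n x))
      \<in> N \<rightarrow>\<^sub>M count_space (carrier G \<times> carrier G)"
    unfolding pair_measure_countable[OF countable countable, symmetric]
    using Suc by (intro measurable_Pair) auto
  then have "(\<lambda>x. (\<lambda>(g, h). g \<otimes> h) (partial_product G (\<lambda>i. f i x) n, f n x))
      \<in> N \<rightarrow>\<^sub>M count_space (carrier G)"
    by (rule measurable_compose) auto
  then show ?case by simp
qed simp

section \<open>Covering, concentration and zero-one alternatives\<close>

text \<open>
  The greedy covering of Katznelson and Weiss. Here \<open>D k n\<close> is the cost of the time interval of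
  length \<open>n\<close> that starts at \<open>k\<close>. From a good time, jump over a stretch of at most \<open>K\<close> steps whose
  cost is at most \<open>t\<close> per step; from a bad time, advance by one step at cost one, which is paid for
  by \<open>b k = 1\<close>. The last stretch, of length at most \<open>K\<close>, is paid for by the summand \<open>K\<close>.
\<close>

lemma subadditive_covering:
  fixes D :: "nat \<Rightarrow> nat \<Rightarrow> real"
  assumes zero: "\<And>k. D k 0 = 0"
    and one: "\<And>k. D k 1 \<le> 1"
    and subadd: "\<And>k m n. D k (m + n) \<le> D k m + D (k + m) n"
    and t: "0 \<le> t"
    and bad: "\<And>k. \<forall>n\<in>{1..K}. real n * t < D k n \<Longrightarrow> b k = (1 :: real)"
    and nonneg: "\<And>k. 0 \<le> b k"
  shows "D k n \<le> real n * t + (\<Sum>i<n. b (k + i)) + real K"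
proof (induction n arbitrary: k rule: less_induct)
  case (less n)
  have linear: "D k n \<le> real n" for k n
  proof (induction n)
    case (Suc n)
    then show ?case using subadd[of k n 1] one[of "k + n"] by simp
  qed (simp add: zero)
  show ?case
  proof (cases "n \<le> K")
    case True
    have "0 \<le> real n * t + (\<Sum>i<n. b (k + i))"
      using t nonneg by (intro add_nonneg_nonneg sum_nonneg) auto
    then show ?thesis using linear[of k n] True by simp
  next
    case False
    have split: "(\<Sum>i<m. b (k + i)) + (\<Sum>i<n-m. b (k + m + i)) = (\<Sum>i<n. b (k + i))" if "m \<le> n" for m
    proof -
      have "(\<Sum>i<m. b (k + i)) + (\<Sum>i\<in>{m..<n}. b (k + i)) = (\<Sum>i<n. b (k + i))"
        using that by (metis atLeast0LessThan sum.atLeastLessThan_concat zero_le)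
      moreover have "(\<Sum>i\<in>{m..<n}. b (k + i)) = (\<Sum>i<n-m. b (k + m + i))"
        using that by (intro sum.reindex_bij_witness[of _ "\<lambda>i. i + m" "\<lambda>i. i - m"]) (auto simp: add_ac)
      ultimately show ?thesis by simp
    qed
    show ?thesis
    proof (cases "\<forall>j\<in>{1..K}. real j * t < D k j")
      case True
      have "D k n \<le> D k 1 + D (k + 1) (n - 1)"
        using subadd[of k 1 "n - 1"] False by simp
      also have "\<dots> \<le> b k + (real (n - 1) * t + (\<Sum>i<n-1. b (k + 1 + i)) + real K)"
        using one[of k] less[of "n - 1" "k + 1"] bad[OF True] False by (intro add_mono) auto
      also have "\<dots> = real (n - 1) * t + (\<Sum>i<n. b (k + i)) + real K"
        using split[of 1] False by simp
      also have "\<dots> \<le> real n * t + (\<Sum>i<n. b (k + i)) + real K"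
        using t by (intro add_right_mono mult_right_mono) auto
      finally show ?thesis .
    next
      case good: False
      then obtain j where j: "1 \<le> j" "j \<le> K" "D k j \<le> real j * t"
        by force
      have "D k n \<le> D k j + D (k + j) (n - j)"
        using subadd[of k j "n - j"] False j by simp
      also have "\<dots> \<le> real j * t + (real (n - j) * t + (\<Sum>i<n-j. b (k + j + i)) + real K)"
        using less[of "n - j" "k + j"] j False by (intro add_mono) auto
      also have "\<dots> = real n * t + (\<Sum>i<n-j. b (k + j + i)) + real K"
        using j False by (simp add: of_nat_diff algebra_simps)
      also have "\<dots> \<le> real n * t + (\<Sum>i<n. b (k + i)) + real K"
        using split[of j] j False nonneg sum_nonneg[of "{..<j}" "\<lambda>i. b (k + i)"] by simp
      finally show ?thesis .
    qed
  qed
qed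

text \<open>
  The upper half of the strong law of large numbers for bounded variables: by the inequality of
  Hoeffding the exceptional probabilities decay geometrically, so the lemma of Borel and Cantelli
  applies.
\<close>

lemma (in prob_space) slln_upper_bounded:
  fixes Y :: "nat \<Rightarrow> 'a \<Rightarrow> real"
  assumes indep: "indep_vars (\<lambda>_. borel) Y UNIV"
    and bounded: "\<And>j. AE \<omega> in M. Y j \<omega> \<in> {0..1}"
    and mean: "\<And>j. expectation (Y j) = e"
    and d: "0 < d"
  shows "AE \<omega> in M. \<forall>\<^sub>F n in sequentially. (\<Sum>j<n. Y j \<omega>) \<le> real n * (e + d)"
proof -
  have rv[measurable]: "Y j \<in> borel_measurable M" for j
    using indep unfolding indep_vars_def by auto
  define A where "A n = {\<omega>\<in>space M. (\<Sum>j<n. Y j \<omega>) \<ge> real n * e + real n * d}" for n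
  have A_le: "prob (A n) \<le> exp (-2 * d\<^sup>2) ^ n" for n
  proof (cases "n = 0")
    case False
    interpret Hoeffding_ineq M "{..<n}" Y "\<lambda>_. 0" "\<lambda>_. 1" "real n * e"
    proof unfold_locales
      show "indep_vars (\<lambda>_. borel) Y {..<n}"
        using indep by (rule indep_vars_subset) auto
    qed (use bounded mean in auto)
    have "prob (A n) \<le> exp (-2 * (real n * d)\<^sup>2 / real n)"
      using Hoeffding_ineq_ge[of "real n * d"] d False unfolding A_def by simp
    also have "-2 * (real n * d)\<^sup>2 / real n = real n * (-2 * d\<^sup>2)"
      using False by (simp add: power2_eq_square)
    finally show ?thesis by (simp only: exp_of_nat_mult)
  qed simp
  have "summable (\<lambda>n. exp (-2 * d\<^sup>2) ^ n)"
    using d by (intro summable_geometric) simp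
  then have "summable (\<lambda>n. prob (A n))"
    by (rule summable_comparison_test[rotated]) (use A_le in auto)
  then have "AE \<omega> in M. \<forall>\<^sub>F n in sequentially. \<omega> \<in> space M - A n"
    by (intro borel_cantelli_AE1) (auto simp: A_def less_top[symmetric])
  then show ?thesis
  proof eventually_elim
    case (elim \<omega>)
    show ?case using elim
      by eventually_elim (auto simp: A_def algebra_simps)
  qed
qed

lemma (in prob_space) AE_constant_if_zero_one:
  fixes Y :: "'a \<Rightarrow> real"
  assumes int: "integrable M Y"
    and zero_one: "\<And>a. prob {\<omega>\<in>space M. Y \<omega> \<le> a} = 0 \<or> prob {\<omega>\<in>space M. Y \<omega> \<le> a} = 1"
  shows "AE \<omega> in M. Y \<omega> = expectation Y"
proof -
  let ?c = "expectation Y"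
  have [measurable]: "Y \<in> borel_measurable M"
    using int by auto
  \<comment> \<open>A variable cannot exceed its mean almost surely; by the zero-one alternative it is then almost
    surely at most its mean, and so equal to it.\<close>
  have "prob {\<omega>\<in>space M. Y \<omega> \<le> ?c} \<noteq> 0"
  proof
    assume "prob {\<omega>\<in>space M. Y \<omega> \<le> ?c} = 0"
    then have "AE \<omega> in M. \<not> Y \<omega> \<le> ?c"
      by (subst (asm) prob_eq_0) auto
    then have "AE \<omega> in M. ?c < Y \<omega>" by (simp add: not_le)
    from expectation_greater[OF int this] show False by simp
  qed
  then have "prob {\<omega>\<in>space M. Y \<omega> \<le> ?c} = 1" using zero_one by blast
  then have le: "AE \<omega> in M. Y \<omega> \<le> ?c"
    by (subst (asm) prob_eq_1) auto
  have "expectation (\<lambda>\<omega>. ?c - Y \<omega>) = 0"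
    using int by (simp add: prob_space)
  then have "AE \<omega> in M. ?c - Y \<omega> = 0"
    using int le by (subst (asm) integral_nonneg_eq_0_iff_AE) auto
  then show ?thesis by auto
qed

section \<open>Random walks on countable groups\<close>

locale iid_group_walk = prob_space M + group G for M :: "'w measure" and G (structure) +
  fixes X :: "nat \<Rightarrow> 'w \<Rightarrow> 'g"
  assumes countable: "countable (carrier G)"
    and indep: "indep_vars (\<lambda>_. count_space (carrier G)) X UNIV"
    and identical: "distr M (count_space (carrier G)) (X i) = distr M (count_space (carrier G)) (X 0)"
begin

text \<open>
  The increment of the random walk between the times \<open>k\<close> and \<open>k + n\<close>. A starting time other than
  zero occurs because the covering argument starts stretches at arbitrary times.
\<close>

definition walk :: "nat \<Rightarrow> nat \<Rightarrow> 'w \<Rightarrow> 'g" where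
  "walk k n \<omega> = partial_product G (\<lambda>i. X (k + i) \<omega>) n"

lemma measurable_X[measurable]: "X i \<in> M \<rightarrow>\<^sub>M count_space (carrier G)"
  using indep unfolding indep_vars_def by auto

lemma X_closed: "\<omega> \<in> space M \<Longrightarrow> X i \<omega> \<in> carrier G"
  using measurable_space[OF measurable_X] by simp

lemma walk_closed: "\<omega> \<in> space M \<Longrightarrow> walk k n \<omega> \<in> carrier G"
  unfolding walk_def by (intro partial_product_closed X_closed)

lemma walk_add: "\<omega> \<in> space M \<Longrightarrow> walk k (m + n) \<omega> = walk k m \<omega> \<otimes> walk (k + m) n \<omega>"
  unfolding walk_def by (subst partial_product_add) (auto simp: X_closed add.assoc)

lemma walk_1: "\<omega> \<in> space M \<Longrightarrow> walk k (Suc 0) \<omega> = X k \<omega>"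
  by (simp add: walk_def X_closed)

lemma measurable_walk[measurable]: "walk k n \<in> M \<rightarrow>\<^sub>M count_space (carrier G)"
  unfolding walk_def[abs_def] by (intro measurable_partial_product countable) measurable

lemma distr_shift:
  "distr M (Pi\<^sub>M UNIV (\<lambda>_. count_space (carrier G))) (\<lambda>\<omega> i. X (k + i) \<omega>) =
   Pi\<^sub>M UNIV (\<lambda>_. distr M (count_space (carrier G)) (X 0))"
proof -
  have "indep_vars (\<lambda>_. count_space (carrier G)) (\<lambda>j \<omega>. (\<lambda>s. s (k + j)) (restrict (\<lambda>i. X i \<omega>) {k + j})) UNIV"
    by (rule indep_vars_compose2[OF indep_vars_restrict[OF indep]])
      (auto simp: disjoint_family_on_def intro!: measurable_component_singleton)
  then have "indep_vars (\<lambda>_. count_space (carrier G)) (\<lambda>j. X (k + j)) UNIV"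
    by simp
  then show ?thesis
    by (subst (asm) indep_vars_iff_distr_eq_PiM) (auto simp: identical[of "k + _"] restrict_UNIV)
qed

text \<open>
  Stationarity, for functionals of the entire sequence: the events of the covering argument involve
  several increments of the walk at once.
\<close>

lemma expectation_shift:
  fixes F :: "(nat \<Rightarrow> 'g) \<Rightarrow> real"
  assumes [measurable]: "F \<in> borel_measurable (Pi\<^sub>M UNIV (\<lambda>_. count_space (carrier G)))"
  shows "expectation (\<lambda>\<omega>. F (\<lambda>i. X (k + i) \<omega>)) = expectation (\<lambda>\<omega>. F (\<lambda>i. X i \<omega>))"
proof -
  have meas: "(\<lambda>\<omega> i. X (k + i) \<omega>) \<in> M \<rightarrow>\<^sub>M Pi\<^sub>M UNIV (\<lambda>_. count_space (carrier G))" for k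
    by (rule measurable_PiM_single') (auto simp: X_closed PiE_iff)
  show ?thesis
    using integral_distr[OF meas[of k], of F] integral_distr[OF meas[of 0], of F]
      distr_shift[of k] distr_shift[of 0] by simp
qed

lemma indep_blocks:
  "indep_vars (\<lambda>_. count_space (carrier G)) (\<lambda>j. walk (j * m) m) UNIV"
proof -
  let ?B = "\<lambda>j. {j * m..<j * m + m}"
  let ?Y = "\<lambda>j s. partial_product G (\<lambda>i. s (j * m + i)) m"
  have "disjoint_family_on ?B UNIV"
    unfolding disjoint_family_on_def
  proof (intro ballI impI)
    fix i j :: nat assume "i \<noteq> j"
    have "x div m = i" if "x \<in> ?B i" for x i
      using that by (intro div_nat_eqI) (auto simp: algebra_simps)
    then show "?B i \<inter> ?B j = {}" using \<open>i \<noteq> j\<close> by blast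
  qed
  then have "indep_vars (\<lambda>_. count_space (carrier G))
      (\<lambda>j \<omega>. ?Y j (restrict (\<lambda>i. X i \<omega>) (?B j))) UNIV"
    by (intro indep_vars_compose2[OF indep_vars_restrict[OF indep]] measurable_partial_product
        countable measurable_component_singleton) auto
  moreover have "?Y j (restrict (\<lambda>i. X i \<omega>) (?B j)) = walk (j * m) m \<omega>" for j \<omega>
    unfolding walk_def by (rule partial_product_cong) simp
  ultimately show ?thesis by simp
qed

lemma indep_walk_next:
  "indep_var (count_space (carrier G)) (walk 0 n) (count_space (carrier G)) (X n)"
proof -
  have "indep_var (count_space (carrier G))
      ((\<lambda>s. partial_product G s n) \<circ> (\<lambda>\<omega>. restrict (\<lambda>i. X i \<omega>) {..<n}))
      (count_space (carrier G)) ((\<lambda>s. s n) \<circ> (\<lambda>\<omega>. restrict (\<lambda>i. X i \<omega>) {n}))"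
    by (intro indep_var_compose[OF indep_var_restrict[OF indep]] measurable_partial_product
        countable measurable_component_singleton) auto
  moreover have "(\<lambda>s. partial_product G s n) \<circ> (\<lambda>\<omega>. restrict (\<lambda>i. X i \<omega>) {..<n}) = walk 0 n"
    by (auto simp: walk_def fun_eq_iff intro!: partial_product_cong)
  moreover have "(\<lambda>s. s n) \<circ> (\<lambda>\<omega>. restrict (\<lambda>i. X i \<omega>) {n}) = X n"
    by auto
  ultimately show ?thesis by simp
qed

text \<open>
  Conditioning on the increment \<open>X n\<close>, which is independent of the walk up to time \<open>n\<close>.
\<close>

lemma expectation_step:
  fixes f :: "'g \<Rightarrow> 'g \<Rightarrow> real"
  assumes S: "finite S" "S \<subseteq> carrier G" "AE \<omega> in M. X n \<omega> \<in> S"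
    and bounded: "\<And>g s. g \<in> carrier G \<Longrightarrow> s \<in> S \<Longrightarrow> \<bar>f g s\<bar> \<le> B"
  shows "expectation (\<lambda>\<omega>. f (walk 0 n \<omega>) (X n \<omega>)) =
    (\<Sum>s\<in>S. prob {\<omega>\<in>space M. X n \<omega> = s} * expectation (\<lambda>\<omega>. f (walk 0 n \<omega>) s))"
proof -
  let ?i = "\<lambda>s \<omega>. indicator {s} (X n \<omega>) :: real" and ?f = "\<lambda>s \<omega>. f (walk 0 n \<omega>) s"
  have i_meas[measurable]: "?i s \<in> borel_measurable M" for s
    by (rule measurable_compose[OF measurable_X]) auto
  have f_meas[measurable]: "?f s \<in> borel_measurable M" for s
    by (rule measurable_compose[OF measurable_walk]) auto
  have i_int: "integrable M (?i s)" for s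
    by (rule integrable_const_bound[where B = 1]) (auto simp: indicator_def)
  have f_int: "integrable M (?f s)" if "s \<in> S" for s
    by (rule integrable_const_bound[where B = B]) (auto intro!: AE_I2 bounded walk_closed that)
  have "indep_var borel (?f s) borel (?i s)" for s
    using indep_var_compose[OF indep_walk_next, of "\<lambda>g. f g s" borel "indicator {s} :: _ \<Rightarrow> real" borel n]
    by (simp add: comp_def)
  note prod = indep_var_lebesgue_integral[OF this f_int i_int] indep_var_integrable[OF this f_int i_int]
  have "expectation (\<lambda>\<omega>. f (walk 0 n \<omega>) (X n \<omega>)) = expectation (\<lambda>\<omega>. \<Sum>s\<in>S. ?f s \<omega> * ?i s \<omega>)"
  proof (rule integral_cong_AE)
    show "AE \<omega> in M. f (walk 0 n \<omega>) (X n \<omega>) = (\<Sum>s\<in>S. ?f s \<omega> * ?i s \<omega>)"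
      using S(3)
    proof eventually_elim
      case (elim \<omega>)
      have "(\<Sum>s\<in>S. ?f s \<omega> * ?i s \<omega>) = (\<Sum>s\<in>S. if s = X n \<omega> then ?f s \<omega> else 0)"
        by (intro sum.cong) (auto simp: indicator_def)
      then show ?case using S(1) elim by simp
    qed
    have "(\<lambda>\<omega>. (walk 0 n \<omega>, X n \<omega>)) \<in> M \<rightarrow>\<^sub>M count_space (carrier G \<times> carrier G)"
      unfolding pair_measure_countable[OF countable countable, symmetric] by measurable
    from measurable_compose[OF this, of "\<lambda>(g, s). f g s" borel]
    show "(\<lambda>\<omega>. f (walk 0 n \<omega>) (X n \<omega>)) \<in> borel_measurable M" by simp
  qed measurable
  also have "\<dots> = (\<Sum>s\<in>S. expectation (\<lambda>\<omega>. ?f s \<omega> * ?i s \<omega>))"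
    by (intro Bochner_Integration.integral_sum prod(2))
  also have "\<dots> = (\<Sum>s\<in>S. prob {\<omega>\<in>space M. X n \<omega> = s} * expectation (?f s))"
  proof (intro sum.cong refl)
    fix s assume s: "s \<in> S"
    have "expectation (?i s) = expectation (indicator {\<omega>\<in>space M. X n \<omega> = s})"
      by (intro Bochner_Integration.integral_cong) (auto simp: indicator_def)
    also have "\<dots> = prob {\<omega>\<in>space M. X n \<omega> = s}" by simp
    finally show "expectation (\<lambda>\<omega>. ?f s \<omega> * ?i s \<omega>) =
        prob {\<omega>\<in>space M. X n \<omega> = s} * expectation (?f s)"
      using prod(1)[OF s] by simp
  qed
  finally show ?thesis .
qed

end

section \<open>The rate of a subadditive length\<close>

locale subadditive_walk = iid_group_walk M G X
  for M :: "'w measure" and G (structure) and X :: "nat \<Rightarrow> 'w \<Rightarrow> 'g" +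
  fixes L :: "'g \<Rightarrow> real"
  assumes L_nonneg: "g \<in> carrier G \<Longrightarrow> 0 \<le> L g"
    and L_one: "L \<one> = 0"
    and L_subadd: "g \<in> carrier G \<Longrightarrow> h \<in> carrier G \<Longrightarrow> L (g \<otimes> h) \<le> L g + L h"
    and L_step: "AE \<omega> in M. L (X i \<omega>) \<le> 1"
begin

lemma L_walk_subadd:
  "\<omega> \<in> space M \<Longrightarrow> L (walk k (m + n) \<omega>) \<le> L (walk k m \<omega>) + L (walk (k + m) n \<omega>)"
  by (simp add: walk_add L_subadd walk_closed)

lemma AE_L_walk_le: "AE \<omega> in M. \<forall>k n. L (walk k n \<omega>) \<le> real n"
proof -
  have "AE \<omega> in M. \<forall>i. L (X i \<omega>) \<le> 1"
    using L_step by (simp add: AE_all_countable)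
  then show ?thesis
  proof (rule AE_mp, intro AE_I2 impI allI)
    fix \<omega> k n assume \<omega>: "\<omega> \<in> space M" and le: "\<forall>i. L (X i \<omega>) \<le> 1"
    show "L (walk k n \<omega>) \<le> real n"
    proof (induction n)
      case 0
      show ?case by (simp add: walk_def L_one)
    next
      case (Suc n)
      show ?case
        using L_walk_subadd[OF \<omega>, of k n 1] walk_1[OF \<omega>, of "k + n"] Suc le[rule_format, of "k + n"]
        by simp
    qed
  qed
qed

lemma measurable_L[measurable]: "(\<lambda>\<omega>. L (walk k n \<omega>)) \<in> borel_measurable M"
  by (rule measurable_compose[OF measurable_walk]) auto

definition lower_rate :: "'w \<Rightarrow> ereal" where
  "lower_rate \<omega> = liminf (\<lambda>n. ereal (L (walk 0 n \<omega>) / real n))"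

text \<open>
  Deleting the first \<open>k\<close> increments is left multiplication by the inverse of \<open>walk 0 k\<close>. By
  subadditivity this changes the length by at most a constant that does not depend on \<open>n\<close>.
  The equation holds at every point, and not just almost surely: a tail event has to be an element
  of each tail \<open>\<sigma>\<close>-algebra, and those need not contain the null sets.
\<close>

lemma lower_rate_shift:
  assumes \<omega>: "\<omega> \<in> space M"
  shows "lower_rate \<omega> = liminf (\<lambda>n. ereal (L (walk k n \<omega>) / real n))"
proof -
  let ?g = "walk 0 k \<omega>"
  let ?C = "max (L ?g) (L (inv ?g))"
  have diff: "\<bar>L (walk 0 (n + k) \<omega>) - L (walk k n \<omega>)\<bar> \<le> ?C" for n
  proof -
    have eq: "walk 0 (n + k) \<omega> = ?g \<otimes> walk k n \<omega>"
      using walk_add[OF \<omega>, of 0 k n] by (simp add: add.commute)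
    then have "L (walk 0 (n + k) \<omega>) \<le> L ?g + L (walk k n \<omega>)"
      using \<omega> by (simp add: L_subadd walk_closed)
    moreover have "walk k n \<omega> = inv ?g \<otimes> walk 0 (n + k) \<omega>"
      using \<omega> by (simp add: eq walk_closed m_assoc[symmetric])
    then have "L (walk k n \<omega>) \<le> L (inv ?g) + L (walk 0 (n + k) \<omega>)"
      using \<omega> L_subadd[of "inv ?g" "walk 0 (n + k) \<omega>"] by (simp add: walk_closed)
    ultimately show ?thesis by linarith
  qed
  let ?u = "\<lambda>n. (L (walk 0 (n + k) \<omega>) - L (walk k n \<omega>)) / real (n + k)"
  let ?v = "\<lambda>n. real n / real (n + k)"
  have "(\<lambda>n. ?C / real (n + k)) \<longlonglongrightarrow> 0"
    by (rule LIMSEQ_ignore_initial_segment[OF lim_const_over_n])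
  then have "?u \<longlonglongrightarrow> 0"
    by (rule Lim_null_comparison[rotated]) (use diff in \<open>auto intro!: always_eventually divide_right_mono\<close>)
  then have u: "(\<lambda>n. ereal (?u n)) \<longlonglongrightarrow> ereal 0" by simp
  have "?v \<longlonglongrightarrow> 1" by real_asymp
  then have v: "(\<lambda>n. ereal (?v n)) \<longlonglongrightarrow> ereal 1" by simp
  have "lower_rate \<omega> = liminf (\<lambda>n. ereal (L (walk 0 (n + k) \<omega>) / real (n + k)))"
    unfolding lower_rate_def by (rule liminf_shift_k[symmetric])
  also have "(\<lambda>n. ereal (L (walk 0 (n + k) \<omega>) / real (n + k))) =
      (\<lambda>n. ereal (?u n) + ereal (?v n) * ereal (L (walk k n \<omega>) / real n))"
  proof
    fix n
    show "ereal (L (walk 0 (n + k) \<omega>) / real (n + k)) =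
        ereal (?u n) + ereal (?v n) * ereal (L (walk k n \<omega>) / real n)"
    proof (cases "n = 0")
      case True
      then show ?thesis by (simp add: walk_def L_one)
    next
      case False
      then show ?thesis by (simp add: diff_divide_distrib)
    qed
  qed
  also have "liminf \<dots> = liminf (\<lambda>n. ereal (?v n) * ereal (L (walk k n \<omega>) / real n))"
    by (subst ereal_liminf_lim_add[OF u]) (simp_all add: zero_ereal_def[symmetric])
  also have "\<dots> = liminf (\<lambda>n. ereal (L (walk k n \<omega>) / real n))"
    by (subst ereal_liminf_lim_mult[OF v]) (simp_all add: one_ereal_def[symmetric])
  finally show ?thesis .
qed

text \<open>
  By \<open>lower_rate_shift\<close>, the lower rate is measurable with respect to the increments after any
  given time, so its level sets are tail events.
\<close>

lemma lower_rate_zero_one: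
  fixes a :: real
  defines "E \<equiv> {\<omega>\<in>space M. real_of_ereal (lower_rate \<omega>) \<le> a}"
  shows "prob E = 0 \<or> prob E = 1"
proof -
  define A where "A i = {X i -` B \<inter> space M | B. B \<subseteq> carrier G}" for i
  have A_alt: "A i = sets (vimage_algebra (space M) (X i) (count_space (carrier G)))" for i
    by (subst sets_vimage_algebra2) (auto simp: A_def X_closed)
  show ?thesis
  proof (rule kolmogorov_0_1_law)
    show "sigma_algebra (space M) (A i)" for i
      unfolding A_alt using sets.sigma_algebra_axioms[of "vimage_algebra (space M) (X i) (count_space (carrier G))"]
      by simp
    show "indep_sets A UNIV"
      using indep unfolding indep_vars_def2 A_def by auto
    show "E \<in> tail_events A"
      unfolding tail_events_def
    proof (rule INT_I)
      fix k :: nat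
      let ?\<F> = "\<Union> (A ` {k..})"
      let ?N = "sigma (space M) ?\<F>"
      have F: "?\<F> \<subseteq> Pow (space M)" by (auto simp: A_def)
      have X: "X (k + i) \<in> ?N \<rightarrow>\<^sub>M count_space (carrier G)" for i
      proof (rule measurableI)
        fix B assume "B \<in> sets (count_space (carrier G))"
        then have "X (k + i) -` B \<inter> space M \<in> ?\<F>"
          by (auto simp: A_def intro!: bexI[of _ "k + i"])
        then show "X (k + i) -` B \<inter> space ?N \<in> sets ?N"
          using F by (simp add: space_measure_of sets_measure_of sigma_sets.Basic)
      qed (use F in \<open>auto simp: space_measure_of X_closed\<close>)
      have [measurable]: "walk k n \<in> ?N \<rightarrow>\<^sub>M count_space (carrier G)" for n
        unfolding walk_def[abs_def] by (intro measurable_partial_product countable X)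
      have [measurable]: "(\<lambda>\<omega>. L (walk k n \<omega>)) \<in> borel_measurable ?N" for n
        by (rule measurable_compose[of _ _ "count_space (carrier G)"]) auto
      have "{\<omega>\<in>space ?N. real_of_ereal (liminf (\<lambda>n. ereal (L (walk k n \<omega>) / real n))) \<le> a} \<in> sets ?N"
        by measurable
      also have "{\<omega>\<in>space ?N. real_of_ereal (liminf (\<lambda>n. ereal (L (walk k n \<omega>) / real n))) \<le> a} = E"
        using F unfolding E_def by (auto simp: space_measure_of lower_rate_shift[of _ k])
      finally show "E \<in> sigma_sets (space M) ?\<F>"
        using F by (simp add: sets_measure_of)
    qed
  qed
qed

lemma lower_rate_constant:
  obtains c where "0 \<le> c" "AE \<omega> in M. lower_rate \<omega> = ereal c"
proof -
  let ?Y = "\<lambda>\<omega>. real_of_ereal (lower_rate \<omega>)"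
  have bounds: "AE \<omega> in M. 0 \<le> lower_rate \<omega> \<and> lower_rate \<omega> \<le> 1"
    using AE_L_walk_le
  proof (rule AE_mp, intro AE_I2 impI conjI)
    fix \<omega> assume \<omega>: "\<omega> \<in> space M" and le: "\<forall>k n. L (walk k n \<omega>) \<le> real n"
    show "0 \<le> lower_rate \<omega>"
      unfolding lower_rate_def
      by (rule Liminf_bounded) (auto intro!: always_eventually divide_nonneg_nonneg L_nonneg walk_closed \<omega>)
    have "L (walk 0 n \<omega>) / real n \<le> 1" for n
      using le by (cases "n = 0") (auto simp: divide_simps)
    then have "lower_rate \<omega> \<le> limsup (\<lambda>n. 1)"
      unfolding lower_rate_def
      by (intro order.trans[OF Liminf_le_Limsup Limsup_mono] always_eventually)
        (auto simp: one_ereal_def)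
    then show "lower_rate \<omega> \<le> 1" by (simp add: Limsup_const)
  qed
  have real: "AE \<omega> in M. lower_rate \<omega> = ereal (?Y \<omega>) \<and> 0 \<le> ?Y \<omega> \<and> ?Y \<omega> \<le> 1"
    using bounds
  proof eventually_elim
    case (elim \<omega>)
    then show ?case by (cases "lower_rate \<omega>") (auto simp: one_ereal_def)
  qed
  have [measurable]: "lower_rate \<in> borel_measurable M"
    unfolding lower_rate_def[abs_def] by measurable
  have "AE \<omega> in M. norm (?Y \<omega>) \<le> 1"
    using real by eventually_elim (simp only: real_norm_def, linarith)
  then have int: "integrable M ?Y"
    by (rule integrable_const_bound) measurable
  have "AE \<omega> in M. ?Y \<omega> = expectation ?Y"
    by (rule AE_constant_if_zero_one[OF int lower_rate_zero_one])
  with real have "AE \<omega> in M. lower_rate \<omega> = ereal (expectation ?Y)"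
    by eventually_elim auto
  moreover have "0 \<le> expectation ?Y"
    by (rule integral_nonneg_AE) (use real in auto)
  ultimately show ?thesis using that by blast
qed

text \<open>
  The event that no stretch of at most \<open>K\<close> steps that starts at time \<open>k\<close> achieves the rate \<open>t\<close>.
\<close>

definition bad_event :: "real \<Rightarrow> nat \<Rightarrow> nat \<Rightarrow> 'w set" where
  "bad_event t K k = {\<omega>\<in>space M. \<forall>n\<in>{1..K}. real n * t < L (walk k n \<omega>)}"

lemma measurable_bad_event[measurable]: "bad_event t K k \<in> events"
  unfolding bad_event_def by measurable

lemma prob_bad_event_shift: "prob (bad_event t K k) = prob (bad_event t K 0)"
proof -
  let ?P = "Pi\<^sub>M UNIV (\<lambda>_ :: nat. count_space (carrier G))"
  let ?S = "{s\<in>space ?P. \<forall>n\<in>{1..K}. real n * t < L (partial_product G s n)}"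
  have [measurable]: "(\<lambda>s. L (partial_product G s n)) \<in> borel_measurable ?P" for n
    by (rule measurable_compose[OF measurable_partial_product[OF countable]])
      (auto intro: measurable_component_singleton)
  have [measurable]: "?S \<in> sets ?P" by measurable
  have "prob (bad_event t K k) = expectation (\<lambda>\<omega>. indicator ?S (\<lambda>i. X (k + i) \<omega>))" for k
  proof -
    have "prob (bad_event t K k) = expectation (indicator (bad_event t K k))"
      by simp
    also have "\<dots> = expectation (\<lambda>\<omega>. indicator ?S (\<lambda>i. X (k + i) \<omega>))"
      by (intro Bochner_Integration.integral_cong)
        (auto simp: indicator_def bad_event_def walk_def space_PiM PiE_iff X_closed)
    finally show ?thesis .
  qed
  note prob = this
  have "(indicator ?S :: _ \<Rightarrow> real) \<in> borel_measurable ?P" by measurable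
  from expectation_shift[OF this, of k] prob[of k] prob[of 0] show ?thesis
    by (simp only: add_0)
qed

text \<open>
  If \<open>t\<close> exceeds the lower rate, then almost surely some stretch starting at time \<open>0\<close> achieves the
  rate \<open>t\<close>, and with high probability it is not longer than a suitable \<open>K\<close>.
\<close>

lemma prob_bad_event_small:
  assumes "AE \<omega> in M. lower_rate \<omega> < ereal t" and \<epsilon>: "0 < \<epsilon>"
  obtains K where "prob (bad_event t K 0) < \<epsilon>"
proof -
  have "AE \<omega> in M. \<omega> \<notin> (\<Inter>K. bad_event t K 0)"
    using assms(1)
  proof eventually_elim
    case (elim \<omega>)
    then have "\<exists>\<^sub>F n in sequentially. ereal (L (walk 0 n \<omega>) / real n) < ereal t"
      unfolding lower_rate_def frequently_def not_less
      by (metis Liminf_bounded not_less)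
    then obtain n where "1 \<le> n" "L (walk 0 n \<omega>) / real n < t"
      unfolding frequently_sequentially by (metis ereal_less(1) less_ereal.simps(1))
    then have "\<omega> \<notin> bad_event t n 0"
      by (auto simp: bad_event_def field_simps intro!: bexI[of _ n])
    then show ?case by blast
  qed
  then have "prob (\<Inter>K. bad_event t K 0) = 0"
    by (subst prob_eq_0) auto
  moreover have "decseq (\<lambda>K. bad_event t K 0)"
    by (auto simp: decseq_def bad_event_def)
  then have "(\<lambda>K. prob (bad_event t K 0)) \<longlonglongrightarrow> prob (\<Inter>K. bad_event t K 0)"
    by (intro finite_Lim_measure_decseq) auto
  ultimately have "\<forall>\<^sub>F K in sequentially. prob (bad_event t K 0) < \<epsilon>"
    using \<epsilon> by (intro order_tendstoD(2)) auto
  then show ?thesis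
    using that by (metis eventually_happens trivial_limit_sequentially)
qed

text \<open>
  The covering bound, integrated: by stationarity every time is bad with the same probability.
\<close>

lemma expectation_L_le:
  assumes t: "0 \<le> t"
  shows "expectation (\<lambda>\<omega>. L (walk 0 n \<omega>)) \<le> real n * t + real n * prob (bad_event t K 0) + real K"
proof -
  let ?b = "\<lambda>k \<omega>. indicator (bad_event t K k) \<omega> :: real"
  have "AE \<omega> in M. L (walk 0 n \<omega>) \<le> real n * t + (\<Sum>i<n. ?b i \<omega>) + real K"
    using AE_L_walk_le
  proof (rule AE_mp, intro AE_I2 impI)
    fix \<omega> assume \<omega>: "\<omega> \<in> space M" and le: "\<forall>k n. L (walk k n \<omega>) \<le> real n"
    have "L (walk 0 n \<omega>) \<le> real n * t + (\<Sum>i<n. ?b (0 + i) \<omega>) + real K"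
    proof (rule subadditive_covering[where D = "\<lambda>k n. L (walk k n \<omega>)" and b = "\<lambda>k. ?b k \<omega>"])
      show "L (walk k 0 \<omega>) = 0" for k by (simp add: walk_def L_one)
      show "L (walk k 1 \<omega>) \<le> 1" for k using le[rule_format, of k 1] by simp
    qed (use t \<omega> in \<open>auto simp: L_walk_subadd bad_event_def\<close>)
    then show "L (walk 0 n \<omega>) \<le> real n * t + (\<Sum>i<n. ?b i \<omega>) + real K" by simp
  qed
  moreover have "integrable M (\<lambda>\<omega>. L (walk 0 n \<omega>))"
  proof (rule integrable_const_bound)
    show "AE \<omega> in M. norm (L (walk 0 n \<omega>)) \<le> real n"
      using AE_L_walk_le by (rule AE_mp) (auto intro!: AE_I2 simp: L_nonneg walk_closed)
  qed measurable
  ultimately have "expectation (\<lambda>\<omega>. L (walk 0 n \<omega>)) \<le>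
      expectation (\<lambda>\<omega>. real n * t + (\<Sum>i<n. ?b i \<omega>) + real K)"
    by (intro integral_mono_AE) (auto intro!: Bochner_Integration.integrable_add
        Bochner_Integration.integrable_sum simp: less_top[symmetric])
  also have "\<dots> = real n * t + (\<Sum>i<n. prob (bad_event t K i)) + real K"
    by (simp add: prob_space less_top[symmetric])
  also have "(\<Sum>i<n. prob (bad_event t K i)) = real n * prob (bad_event t K 0)"
    by (subst prob_bad_event_shift) simp
  finally show ?thesis .
qed

lemma expectation_L_shift:
  "expectation (\<lambda>\<omega>. L (walk k n \<omega>)) = expectation (\<lambda>\<omega>. L (walk 0 n \<omega>))"
proof -
  have "(\<lambda>s. L (partial_product G s n)) \<in> borel_measurable (Pi\<^sub>M UNIV (\<lambda>_. count_space (carrier G)))"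
    by (rule measurable_compose[OF measurable_partial_product[OF countable]])
      (auto intro: measurable_component_singleton)
  from expectation_shift[OF this, of k] show ?thesis
    by (simp add: walk_def)
qed

text \<open>
  Up to an incomplete last block, \<open>L (walk 0 n)\<close> is at most the sum of the lengths of consecutive
  blocks of \<open>m\<close> steps. These are independent, and divided by \<open>m\<close> they lie in the unit interval.
\<close>

lemma AE_upper_rate:
  assumes m: "0 < m" and e: "expectation (\<lambda>\<omega>. L (walk 0 m \<omega>)) \<le> real m * e"
    and \<epsilon>: "0 < \<epsilon>" and "0 \<le> e"
  shows "AE \<omega> in M. \<forall>\<^sub>F n in sequentially. L (walk 0 n \<omega>) / real n \<le> e + 2 * \<epsilon>"
proof -
  let ?Y = "\<lambda>j \<omega>. L (walk (j * m) m \<omega>) / real m"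
  let ?e = "expectation (\<lambda>\<omega>. L (walk 0 m \<omega>)) / real m"
  have "AE \<omega> in M. \<forall>\<^sub>F N in sequentially. (\<Sum>j<N. ?Y j \<omega>) \<le> real N * (?e + \<epsilon>)"
  proof (rule slln_upper_bounded)
    show "indep_vars (\<lambda>_. borel) ?Y UNIV"
      by (rule indep_vars_compose2[OF indep_blocks]) auto
    show "AE \<omega> in M. ?Y j \<omega> \<in> {0..1}" for j
      using AE_L_walk_le
      by (rule AE_mp) (use m in \<open>auto intro!: AE_I2 divide_nonneg_nonneg L_nonneg walk_closed\<close>)
    show "expectation (?Y j) = ?e" for j
      by (simp add: expectation_L_shift[of "j * m"])
  qed fact
  with AE_L_walk_le AE_space show ?thesis
  proof eventually_elim
    case (elim \<omega>)
    note le = elim(1)[rule_format] and \<omega> = elim(2)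
    have "?e \<le> e" using e m by (simp add: field_simps)
    obtain N0 where N0: "\<And>N. N0 \<le> N \<Longrightarrow> (\<Sum>j<N. ?Y j \<omega>) \<le> real N * (?e + \<epsilon>)"
      using elim(3) by (auto simp: eventually_sequentially)
    have blocks: "L (walk 0 (N * m) \<omega>) \<le> (\<Sum>j<N. L (walk (j * m) m \<omega>))" for N
    proof (induction N)
      case 0
      show ?case by (simp add: walk_def L_one)
    next
      case (Suc N)
      then show ?case
        using L_walk_subadd[OF \<omega>, of 0 "N * m" m] by (simp add: add.commute)
    qed
    have "L (walk 0 n \<omega>) / real n \<le> e + 2 * \<epsilon>" if n: "n \<ge> N0 * m" "real n \<ge> real m / \<epsilon>" "n > 0" for n
    proof -
      let ?N = "n div m"
      have "N0 \<le> ?N" using n m by (simp add: less_eq_div_iff_mult_less_eq)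
      have "L (walk 0 n \<omega>) \<le> L (walk 0 (?N * m) \<omega>) + L (walk (?N * m) (n mod m) \<omega>)"
        using L_walk_subadd[OF \<omega>, of 0 "?N * m" "n mod m"] by simp
      also have "\<dots> \<le> (\<Sum>j<?N. L (walk (j * m) m \<omega>)) + real (n mod m)"
        by (intro add_mono blocks le)
      also have "(\<Sum>j<?N. L (walk (j * m) m \<omega>)) = real m * (\<Sum>j<?N. ?Y j \<omega>)"
        using m by (simp add: sum_divide_distrib[symmetric])
      also have "\<dots> \<le> real m * (real ?N * (?e + \<epsilon>))"
        by (intro mult_left_mono N0 \<open>N0 \<le> ?N\<close>) auto
      also have "\<dots> \<le> real m * (real ?N * (e + \<epsilon>))"
        using \<open>?e \<le> e\<close> by (intro mult_left_mono) auto
      also have "\<dots> = real (?N * m) * (e + \<epsilon>)" by simp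
      also have "\<dots> \<le> real n * (e + \<epsilon>)"
        using \<epsilon> \<open>0 \<le> e\<close> by (intro mult_right_mono) (auto simp only: of_nat_le_iff div_times_less_eq_dividend)
      also have "real (n mod m) \<le> real n * \<epsilon>"
      proof -
        have "real (n mod m) \<le> real m" using m by (simp add: less_imp_le)
        also have "\<dots> \<le> real n * \<epsilon>" using n \<epsilon> by (simp add: field_simps)
        finally show ?thesis .
      qed
      finally have "L (walk 0 n \<omega>) \<le> (e + 2 * \<epsilon>) * real n"
        by (simp add: algebra_simps)
      then show ?thesis using n by (simp add: divide_le_eq)
    qed
    then show ?case
      by (intro eventually_sequentiallyI[of "max (N0 * m) (max (nat \<lceil>real m / \<epsilon>\<rceil>) 1)"])
        (auto simp: le_nat_iff ceiling_le_iff nat_le_iff)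
  qed
qed

text \<open>
  The subadditive ergodic theorem for lengths of random walks. With \<open>c\<close> the constant value of the
  lower rate, the covering bound for large \<open>m\<close> feeds \<open>AE_upper_rate\<close>, so that the upper rate
  exceeds \<open>c\<close> by an arbitrarily small amount.
\<close>

theorem rate_exists:
  "\<exists>c. AE \<omega> in M. (\<lambda>n. L (walk 0 n \<omega>) / real n) \<longlonglongrightarrow> c"
proof -
  obtain c where c: "0 \<le> c" "AE \<omega> in M. lower_rate \<omega> = ereal c"
    by (rule lower_rate_constant)
  have upper: "AE \<omega> in M. \<forall>\<^sub>F n in sequentially. L (walk 0 n \<omega>) / real n \<le> c + 5 * \<epsilon>"
    if \<epsilon>: "0 < \<epsilon>" for \<epsilon>
  proof -
    have "AE \<omega> in M. lower_rate \<omega> < ereal (c + \<epsilon>)"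
      using c(2) \<epsilon> by auto
    then obtain K where K: "prob (bad_event (c + \<epsilon>) K 0) < \<epsilon>"
      by (rule prob_bad_event_small[OF _ \<epsilon>])
    obtain m where m: "real K / \<epsilon> < real m"
      using reals_Archimedean2 by blast
    have m0: "0 < m"
      using m \<epsilon> by (metis divide_nonneg_pos gr0I leD of_nat_0 of_nat_0_le_iff)
    have "expectation (\<lambda>\<omega>. L (walk 0 m \<omega>)) \<le>
        real m * (c + \<epsilon>) + real m * prob (bad_event (c + \<epsilon>) K 0) + real K"
      using c \<epsilon> by (intro expectation_L_le) auto
    also have "\<dots> \<le> real m * (c + \<epsilon>) + real m * \<epsilon> + real m * \<epsilon>"
      using K m \<epsilon> by (intro add_mono mult_left_mono) (auto simp: field_simps)
    finally have "expectation (\<lambda>\<omega>. L (walk 0 m \<omega>)) \<le> real m * (c + 3 * \<epsilon>)"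
      by (simp add: algebra_simps)
    from AE_upper_rate[OF m0 this \<epsilon>] show ?thesis using c \<epsilon> by (simp add: algebra_simps)
  qed
  have "AE \<omega> in M. \<forall>j::nat. \<forall>\<^sub>F n in sequentially. L (walk 0 n \<omega>) / real n \<le> c + 5 * inverse (real (Suc j))"
    unfolding AE_all_countable using upper by simp
  with c(2) have "AE \<omega> in M. (\<lambda>n. L (walk 0 n \<omega>) / real n) \<longlonglongrightarrow> c"
  proof eventually_elim
    case (elim \<omega>)
    show ?case
    proof (rule order_tendstoI)
      fix a assume "a < c"
      then have "ereal a < liminf (\<lambda>n. ereal (L (walk 0 n \<omega>) / real n))"
        using elim(1) by (simp add: lower_rate_def)
      then have "\<forall>\<^sub>F n in sequentially. ereal a < ereal (L (walk 0 n \<omega>) / real n)"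
        by (rule less_LiminfD)
      then show "\<forall>\<^sub>F n in sequentially. a < L (walk 0 n \<omega>) / real n"
        by simp
    next
      fix a assume "c < a"
      then obtain j where "inverse (real (Suc j)) < (a - c) / 5"
        using reals_Archimedean[of "(a - c) / 5"] by auto
      then have "c + 5 * inverse (real (Suc j)) < a" by (simp add: field_simps)
      then show "\<forall>\<^sub>F n in sequentially. L (walk 0 n \<omega>) / real n < a"
        using elim(2)[rule_format, of j] by (auto elim!: eventually_mono)
    qed
  qed
  then show ?thesis ..
qed

end

section \<open>Distances in Cayley graphs\<close>

lemma (in group) cayley_path_mult:
  assumes "g \<in> carrier G" "(h, k) \<in> cayley_edges G S ^^ n" and S: "S \<subseteq> carrier G"
  shows "(g \<otimes> h, g \<otimes> k) \<in> cayley_edges G S ^^ n"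
  using assms(2)
proof (induction n arbitrary: k)
  case (Suc n)
  then obtain j where j: "(h, j) \<in> cayley_edges G S ^^ n" "(j, k) \<in> cayley_edges G S" by auto
  have "(g \<otimes> j, g \<otimes> k) \<in> cayley_edges G S"
    using j(2) assms(1) S unfolding cayley_edges_def by (auto simp: m_assoc[symmetric] subset_iff)
  then show ?case using Suc.IH[OF j(1)] by auto
qed simp

text \<open>
  The distance is the least element of a set that may be empty; it is attained as soon as there is a
  path at all.
\<close>

lemma (in group) cayley_dist_witness:
  "(g, \<one>) \<in> cayley_edges G S ^^ n \<Longrightarrow> (g, \<one>) \<in> cayley_edges G S ^^ cayley_dist G S g \<one>"
  unfolding cayley_dist_def by (rule LeastI)

lemma cayley_dist_le: "(g, h) \<in> cayley_edges G S ^^ n \<Longrightarrow> cayley_dist G S g h \<le> n"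
  unfolding cayley_dist_def by (rule Least_le)

lemma (in group) cayley_path_to_one_mult:
  assumes "g \<in> carrier G" "h \<in> carrier G" "S \<subseteq> carrier G"
    and "(g, \<one>) \<in> cayley_edges G S ^^ m" "(h, \<one>) \<in> cayley_edges G S ^^ n"
  shows "(g \<otimes> h, \<one>) \<in> cayley_edges G S ^^ (m + n)"
proof -
  have "(g \<otimes> h, g) \<in> cayley_edges G S ^^ n"
    using cayley_path_mult[OF assms(1,5,3)] assms(1) by simp
  then have "(g \<otimes> h, \<one>) \<in> cayley_edges G S ^^ (n + m)"
    using assms(4) unfolding relpow_add by auto
  then show ?thesis by (simp add: add.commute)
qed

lemma (in group) cayley_edge_gen:
  "s \<in> S \<Longrightarrow> S \<subseteq> carrier G \<Longrightarrow> (s, \<one>) \<in> cayley_edges G S"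
  unfolding cayley_edges_def by (auto intro!: bexI[of _ s])

text \<open>
  Lower bounds for distances come from functions that change by at most one along each edge.
\<close>

lemma (in group) cayley_potential_le:
  fixes \<Phi> :: "'a \<Rightarrow> nat"
  assumes "\<And>g s. g \<in> carrier G \<Longrightarrow> s \<in> S \<Longrightarrow> \<Phi> (g \<otimes> s) \<le> \<Phi> g + 1 \<and> \<Phi> g \<le> \<Phi> (g \<otimes> s) + 1"
    and "(g, h) \<in> cayley_edges G S ^^ n"
  shows "\<Phi> g \<le> \<Phi> h + n"
  using assms(2)
proof (induction n arbitrary: h)
  case (Suc n)
  then obtain j where j: "(g, j) \<in> cayley_edges G S ^^ n" "(j, h) \<in> cayley_edges G S" by auto
  have "\<Phi> j \<le> \<Phi> h + 1"
    using j(2) assms(1) unfolding cayley_edges_def by auto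
  then show ?case using Suc.IH[OF j(1)] by simp
qed simp

section \<open>The tree\<close>

lemma tree_group_simps [simp]:
  "x \<otimes>\<^bsub>tree_group q\<^esub> y = foldr push_letter x y" "\<one>\<^bsub>tree_group q\<^esub> = []"
  by (simp_all add: tree_group_def)

lemma tree_carrier_iff: "x \<in> carrier (tree_group q) \<longleftrightarrow> set x \<subseteq> {..<q} \<and> distinct_adj x"
  by (simp add: tree_group_def)

lemma tree_carrier_Cons:
  "a # w \<in> carrier (tree_group q) \<Longrightarrow> a < q \<and> w \<in> carrier (tree_group q) \<and> push_letter a w = a # w"
  by (cases w) (auto simp: tree_carrier_iff)

lemma letter_carrier [simp]: "[a] \<in> carrier (tree_group q) \<longleftrightarrow> a < q"
  by (simp add: tree_carrier_iff)

lemma Nil_carrier [simp]: "[] \<in> carrier (tree_group q)"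
  by (simp add: tree_carrier_iff)

lemma length_push_letter: "length (push_letter a w) \<le> length w + 1"
  by (cases w) auto

lemma length_tree_mult: "length (foldr push_letter u w) \<le> length u + length w"
proof (induction u)
  case (Cons a u)
  then show ?case using length_push_letter[of a "foldr push_letter u w"] by simp
qed simp

lemma tree_mult_letter_letter:
  assumes "x \<in> carrier (tree_group q)" "a < q"
  shows "foldr push_letter (foldr push_letter x [a]) [a] = x"
proof -
  interpret T: group "tree_group q" by (rule group_tree_group)
  have "[a] \<otimes>\<^bsub>tree_group q\<^esub> [a] = \<one>\<^bsub>tree_group q\<^esub>" by simp
  then have "(x \<otimes>\<^bsub>tree_group q\<^esub> [a]) \<otimes>\<^bsub>tree_group q\<^esub> [a] = x"
    using assms by (simp only: T.m_assoc letter_carrier T.r_one)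
  then show ?thesis by simp
qed

text \<open>
  The lower bound on the new length follows from the upper bound, since multiplying by the same
  letter again restores the word.
\<close>

lemma length_mult_letter:
  assumes "x \<in> carrier (tree_group q)" "a < q"
  shows "length (foldr push_letter x [a]) \<le> length x + 1 \<and> length x \<le> length (foldr push_letter x [a]) + 1"
  using length_tree_mult[of x "[a]"] length_tree_mult[of "foldr push_letter x [a]" "[a]"]
  by (simp add: tree_mult_letter_letter[OF assms])

lemma tree_gens_carrier: "tree_gens q \<subseteq> carrier (tree_group q)"
  by (auto simp: tree_gens_def)

lemma tree_length_eq:
  assumes "x \<in> carrier (tree_group q)"
  shows "tree_length q x = length x"
proof -
  interpret T: group "tree_group q" by (rule group_tree_group)
  have path: "(x, \<one>\<^bsub>tree_group q\<^esub>) \<in> cayley_edges (tree_group q) (tree_gens q) ^^ length x"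
    using assms
  proof (induction x)
    case (Cons a w)
    note a = tree_carrier_Cons[OF Cons.prems]
    have "([a], \<one>\<^bsub>tree_group q\<^esub>) \<in> cayley_edges (tree_group q) (tree_gens q) ^^ 1"
      unfolding relpow_1
      using a by (intro T.cayley_edge_gen tree_gens_carrier) (auto simp: tree_gens_def)
    from T.cayley_path_to_one_mult[OF _ _ tree_gens_carrier this Cons.IH]
    show ?case using a by simp
  qed simp
  have "length x \<le> length (\<one>\<^bsub>tree_group q\<^esub>) + cayley_dist (tree_group q) (tree_gens q) x \<one>\<^bsub>tree_group q\<^esub>"
    by (rule T.cayley_potential_le[OF _ T.cayley_dist_witness[OF path]])
      (use length_mult_letter in \<open>auto simp: tree_gens_def\<close>)
  then show ?thesis
    using cayley_dist_le[OF path] by (simp add: tree_length_def)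
qed

section \<open>The lamplighter group\<close>

lemma lamplighter_carrier_iff:
  "g \<in> carrier (lamplighter_group q) \<longleftrightarrow> fst g \<in> configs q \<and> snd g \<in> carrier (tree_group q)"
  by (cases g) (simp add: lamplighter_group_def)

lemma snd_lamplighter_mult [simp]:
  "snd (g \<otimes>\<^bsub>lamplighter_group q\<^esub> h) = foldr push_letter (snd g) (snd h)"
  by (cases g; cases h) (simp add: lamplighter_group_def)

lemma lamplighter_one: "\<one>\<^bsub>lamplighter_group q\<^esub> = (\<lambda>_. 0, [])"
  by (simp add: lamplighter_group_def)

lemma mult_move:
  "(\<eta>, x) \<otimes>\<^bsub>lamplighter_group q\<^esub> (\<lambda>_. 0, y) = (\<eta>, foldr push_letter x y)"
  by (simp add: lamplighter_group_def translate_zero del: add_bit_eq_xor)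

lemma translate_switch:
  assumes "x \<in> carrier (tree_group q)"
  shows "translate q x (\<lambda>w. if w = [] then 1 else 0) = (\<lambda>w. if w = x then 1 else 0)"
proof
  interpret T: group "tree_group q" by (rule group_tree_group)
  fix w
  have "inv\<^bsub>tree_group q\<^esub> x \<otimes>\<^bsub>tree_group q\<^esub> w = \<one>\<^bsub>tree_group q\<^esub> \<longleftrightarrow> w = x"
    if "w \<in> carrier (tree_group q)"
    using assms that by (metis T.inv_closed T.inv_equality T.inv_inv T.l_inv)
  then show "translate q x (\<lambda>w. if w = [] then 1 else 0) w = (if w = x then 1 else 0)"
    using assms by (auto simp: translate_def)
qed

lemma mult_switch:
  assumes "x \<in> carrier (tree_group q)"
  shows "(\<eta>, x) \<otimes>\<^bsub>lamplighter_group q\<^esub> switch_gen = (\<lambda>w. \<eta> w + (if w = x then 1 else 0), x)"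
proof -
  interpret T: group "tree_group q" by (rule group_tree_group)
  have "x \<otimes>\<^bsub>tree_group q\<^esub> \<one>\<^bsub>tree_group q\<^esub> = x" using assms by (rule T.r_one)
  then show ?thesis
    using assms by (simp add: lamplighter_group_def switch_gen_def translate_switch del: add_bit_eq_xor)
qed

lemma lamplighter_gens_carrier: "lamplighter_gens q \<subseteq> carrier (lamplighter_group q)"
  by (auto simp: lamplighter_gens_def switch_gen_def move_gen_def lamplighter_carrier_iff
      zero_configs configs_def)

text \<open>
  Moves generate the tree; conjugating the switch at the root by moves switches any single lamp; and
  a finitely supported configuration is a product of such lamps.
\<close>

lemma lamplighter_generated:
  assumes "g \<in> carrier (lamplighter_group q)"
  shows "\<exists>n. (g, \<one>\<^bsub>lamplighter_group q\<^esub>) \<in> cayley_edges (lamplighter_group q) (lamplighter_gens q) ^^ n"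
proof -
  interpret T: group "tree_group q" by (rule group_tree_group)
  interpret G: group "lamplighter_group q" by (rule group_lamplighter_group)
  define R where "R = {g \<in> carrier (lamplighter_group q).
    \<exists>n. (g, \<one>\<^bsub>lamplighter_group q\<^esub>) \<in> cayley_edges (lamplighter_group q) (lamplighter_gens q) ^^ n}"
  have mult: "g \<otimes>\<^bsub>lamplighter_group q\<^esub> h \<in> R" if "g \<in> R" "h \<in> R" for g h
    using that G.cayley_path_to_one_mult[OF _ _ lamplighter_gens_carrier] unfolding R_def by blast
  have gen: "s \<in> R" if "s \<in> lamplighter_gens q" for s
    using G.cayley_edge_gen[OF that lamplighter_gens_carrier] that lamplighter_gens_carrier
    unfolding R_def by (auto intro: exI[of _ "1 :: nat"])
  have one: "\<one>\<^bsub>lamplighter_group q\<^esub> \<in> R"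
    unfolding R_def by (auto intro: exI[of _ "0 :: nat"])
  have move: "(\<lambda>_. 0, x) \<in> R" if "x \<in> carrier (tree_group q)" for x
    using that
  proof (induction x)
    case Nil
    then show ?case using one by (simp add: lamplighter_one)
  next
    case (Cons a w)
    note a = tree_carrier_Cons[OF Cons.prems]
    have "move_gen a \<otimes>\<^bsub>lamplighter_group q\<^esub> (\<lambda>_. 0, w) \<in> R"
      using a Cons.IH by (intro mult[OF gen]) (auto simp: lamplighter_gens_def)
    then show ?case using a by (simp add: move_gen_def mult_move)
  qed
  have lamp: "(\<lambda>w. if w = x then 1 else 0, []) \<in> R" if x: "x \<in> carrier (tree_group q)" for x
  proof -
    let ?y = "inv\<^bsub>tree_group q\<^esub> x"
    have "foldr push_letter x ?y = []"
      using T.r_inv[OF x] by simp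
    moreover have "((\<lambda>_. 0, x) \<otimes>\<^bsub>lamplighter_group q\<^esub> switch_gen) \<otimes>\<^bsub>lamplighter_group q\<^esub> (\<lambda>_. 0, ?y) \<in> R"
      using x by (intro mult gen move) (auto simp: lamplighter_gens_def)
    ultimately show ?thesis
      using x by (simp add: mult_switch mult_move del: add_bit_eq_xor)
  qed
  have "(\<eta>, x) \<in> R" if "\<eta> \<in> configs q" "x \<in> carrier (tree_group q)" for \<eta> x
    using that(1)
  proof (induction "card {w. \<eta> w \<noteq> 0}" arbitrary: \<eta>)
    case 0
    then have "\<eta> = (\<lambda>_. 0)" by (auto simp: configs_def)
    then show ?case using move that by simp
  next
    case (Suc n)
    then have fin: "finite {w. \<eta> w \<noteq> 0}" by (simp add: configs_def)
    with Suc(2) obtain v where v: "\<eta> v \<noteq> 0"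
      by (metis (mono_tags, lifting) Collect_empty_eq card.empty nat.distinct(1))
    let ?\<theta> = "\<eta>(v := 0)"
    have supp: "{w. ?\<theta> w \<noteq> 0} = {w. \<eta> w \<noteq> 0} - {v}" by auto
    have v_in: "v \<in> carrier (tree_group q)" using v Suc.prems by (auto simp: configs_def)
    have \<theta>: "?\<theta> \<in> configs q"
      using Suc.prems fin unfolding configs_def mem_Collect_eq supp by blast
    have "n = card {w. ?\<theta> w \<noteq> 0}"
      unfolding supp using Suc(2) fin v by simp
    then have "(?\<theta>, x) \<in> R" using \<theta> by (rule Suc(1))
    with lamp[OF v_in] have "(\<lambda>w. if w = v then 1 else 0, []) \<otimes>\<^bsub>lamplighter_group q\<^esub> (?\<theta>, x) \<in> R"
      by (rule mult)
    also have "(\<lambda>w. if w = v then 1 else 0, []) \<otimes>\<^bsub>lamplighter_group q\<^esub> (?\<theta>, x) = (\<eta>, x)"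
      using translate_one[OF \<theta>] v by (auto simp: lamplighter_group_def fun_eq_iff)
    finally show ?case .
  qed
  then have "g \<in> R"
    using assms by (cases g) (simp add: lamplighter_carrier_iff)
  then show ?thesis by (simp add: R_def)
qed

lemma lamplighter_length_mult:
  assumes "g \<in> carrier (lamplighter_group q)" "h \<in> carrier (lamplighter_group q)"
  shows "lamplighter_length q (g \<otimes>\<^bsub>lamplighter_group q\<^esub> h) \<le> lamplighter_length q g + lamplighter_length q h"
proof -
  interpret G: group "lamplighter_group q" by (rule group_lamplighter_group)
  obtain m n where "(g, \<one>\<^bsub>lamplighter_group q\<^esub>) \<in> cayley_edges (lamplighter_group q) (lamplighter_gens q) ^^ m"
    "(h, \<one>\<^bsub>lamplighter_group q\<^esub>) \<in> cayley_edges (lamplighter_group q) (lamplighter_gens q) ^^ n"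
    using assms lamplighter_generated by blast
  then show ?thesis
    unfolding lamplighter_length_def
    by (intro cayley_dist_le G.cayley_path_to_one_mult assms lamplighter_gens_carrier)
      (auto intro: G.cayley_dist_witness)
qed

lemma lamplighter_length_one: "lamplighter_length q \<one>\<^bsub>lamplighter_group q\<^esub> = 0"
  unfolding lamplighter_length_def
  using cayley_dist_le[where n = 0] by fastforce

lemma lamplighter_length_gen:
  assumes "s \<in> lamplighter_gens q"
  shows "lamplighter_length q s \<le> 1"
proof -
  interpret G: group "lamplighter_group q" by (rule group_lamplighter_group)
  show ?thesis
    unfolding lamplighter_length_def
    by (rule cayley_dist_le)
      (simp only: relpow_1 G.cayley_edge_gen[OF assms lamplighter_gens_carrier])
qed

definition bit_sign :: "bit \<Rightarrow> real" where
  "bit_sign b = (if b = 0 then 1 else -1)"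

lemma bit_sign_add_1: "bit_sign (b + 1) = - bit_sign b"
  by (cases b) (auto simp: bit_sign_def)

lemma abs_bit_sign [simp]: "\<bar>bit_sign b\<bar> = 1"
  by (simp add: bit_sign_def)

definition lamps_on :: "config \<times> word \<Rightarrow> nat" where
  "lamps_on g = card {w. fst g w \<noteq> 0}"

lemma lamps_on_move: "lamps_on (g \<otimes>\<^bsub>lamplighter_group q\<^esub> move_gen a) = lamps_on g"
  by (cases g) (simp add: move_gen_def mult_move lamps_on_def)

text \<open>
  The link between the number of lamps that are on and the lamp signs: the increment is \<open>1\<close> or \<open>-1\<close>
  according to the state of the lamp at the current position.
\<close>

lemma lamps_on_switch:
  assumes "g \<in> carrier (lamplighter_group q)"
  shows "real (lamps_on (g \<otimes>\<^bsub>lamplighter_group q\<^esub> switch_gen)) = real (lamps_on g) + bit_sign (fst g (snd g))"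
proof -
  obtain \<eta> x where g: "g = (\<eta>, x)" by (cases g)
  have fin: "finite {w. \<eta> w \<noteq> 0}" and x: "x \<in> carrier (tree_group q)"
    using assms g by (auto simp: lamplighter_carrier_iff configs_def)
  show ?thesis
  proof (cases "\<eta> x = 0")
    case True
    have "{w. \<eta> w + (if w = x then 1 else 0) \<noteq> 0} = insert x {w. \<eta> w \<noteq> 0}"
      using True by (auto split: if_splits)
    then show ?thesis
      using fin True by (simp add: g mult_switch[OF x] lamps_on_def bit_sign_def del: add_bit_eq_xor)
  next
    case False
    have "{w. \<eta> w + (if w = x then 1 else 0) \<noteq> 0} = {w. \<eta> w \<noteq> 0} - {x}"
      using False by (auto split: if_splits)
    moreover have "card {w. \<eta> w \<noteq> 0} > 0" using fin False by (auto simp: card_gt_0_iff)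
    ultimately show ?thesis
      using fin False
      by (simp add: g mult_switch[OF x] lamps_on_def bit_sign_def of_nat_diff del: add_bit_eq_xor)
  qed
qed

text \<open>
  A move changes the first summand by at most one and keeps the second; a switch keeps the first and
  changes the second by one. So the sum is a potential on the Cayley graph.
\<close>

lemma lamplighter_length_ge:
  assumes "g \<in> carrier (lamplighter_group q)"
  shows "length (snd g) + lamps_on g \<le> lamplighter_length q g"
proof -
  interpret G: group "lamplighter_group q" by (rule group_lamplighter_group)
  let ?\<Phi> = "\<lambda>g. length (snd g) + lamps_on g"
  have "?\<Phi> g \<le> ?\<Phi> \<one>\<^bsub>lamplighter_group q\<^esub> + lamplighter_length q g"
    unfolding lamplighter_length_def
  proof (rule G.cayley_potential_le)
    fix g s assume g: "g \<in> carrier (lamplighter_group q)" and "s \<in> lamplighter_gens q"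
    then consider "s = switch_gen" | a where "s = move_gen a" "a < q"
      by (auto simp: lamplighter_gens_def)
    then show "?\<Phi> (g \<otimes>\<^bsub>lamplighter_group q\<^esub> s) \<le> ?\<Phi> g + 1 \<and> ?\<Phi> g \<le> ?\<Phi> (g \<otimes>\<^bsub>lamplighter_group q\<^esub> s) + 1"
    proof cases
      case 1
      have "snd (g \<otimes>\<^bsub>lamplighter_group q\<^esub> switch_gen) = snd g"
        using g by (cases g) (simp add: mult_switch lamplighter_carrier_iff)
      then show ?thesis
        using lamps_on_switch[OF g] 1 by (auto simp: bit_sign_def split: if_splits)
    next
      case 2
      then show ?thesis
        using length_mult_letter[of "snd g" q a] g
        by (simp add: lamps_on_move lamplighter_carrier_iff) (simp add: move_gen_def)
    qed
  next
    show "(g, \<one>\<^bsub>lamplighter_group q\<^esub>) \<in> cayley_edges (lamplighter_group q) (lamplighter_gens q)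
        ^^ cayley_dist (lamplighter_group q) (lamplighter_gens q) g \<one>\<^bsub>lamplighter_group q\<^esub>"
      using lamplighter_generated[OF assms] G.cayley_dist_witness by blast
  qed
  then show ?thesis by (simp add: lamplighter_one lamps_on_def)
qed

lemma countable_lamplighter: "countable (carrier (lamplighter_group q))"
proof -
  have "countable ((\<lambda>\<eta>. {w. \<eta> w \<noteq> 0}) ` configs q)"
    by (rule countable_subset[OF _ countable_Collect_finite]) (auto simp: configs_def)
  moreover have "inj_on (\<lambda>\<eta> :: config. {w. \<eta> w \<noteq> 0}) (configs q)"
  proof (rule inj_onI)
    fix \<eta> \<theta> :: config assume eq: "{w. \<eta> w \<noteq> 0} = {w. \<theta> w \<noteq> 0}"
    show "\<eta> = \<theta>"
    proof
      fix w
      have "\<eta> w \<noteq> 0 \<longleftrightarrow> \<theta> w \<noteq> 0" using eq by blast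
      then show "\<eta> w = \<theta> w" by (cases "\<eta> w"; cases "\<theta> w") auto
    qed
  qed
  ultimately have "countable (configs q)" by (rule countable_image_inj_on)
  then show ?thesis by (simp add: lamplighter_group_def)
qed

section \<open>The lamplighter walk\<close>

lemma finite_lamplighter_gens: "finite (lamplighter_gens q)"
proof -
  have "lamplighter_gens q = insert switch_gen (move_gen ` {..<q})"
    by (auto simp: lamplighter_gens_def)
  then show ?thesis by simp
qed

lemma switch_neq_move: "switch_gen \<noteq> move_gen a"
  by (simp add: switch_gen_def move_gen_def)

lemma sum_lamplighter_gens:
  "(\<Sum>s\<in>lamplighter_gens q. f s) = f switch_gen + (\<Sum>a<q. f (move_gen a))"
proof -
  have "lamplighter_gens q = insert switch_gen (move_gen ` {..<q})"
    by (auto simp: lamplighter_gens_def)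
  moreover have "inj_on move_gen {..<q}"
    by (auto simp: inj_on_def move_gen_def)
  moreover have "switch_gen \<notin> move_gen ` {..<q}"
    using switch_neq_move by auto
  ultimately show ?thesis
    by (simp add: sum.reindex)
qed

lemma step_law_switch: "step_law q p switch_gen = p"
  by (simp add: step_law_def)

lemma step_law_move: "a < q \<Longrightarrow> step_law q p (move_gen a) = (1 - p) / real q"
  using switch_neq_move by (auto simp: step_law_def)

locale lamplighter_walk = prob_space M for M :: "'w measure" +
  fixes q :: nat and p :: real and \<xi> :: "nat \<Rightarrow> 'w \<Rightarrow> config \<times> word"
  assumes q: "q \<ge> 3" and p: "0 < p" "p < 1"
    and indep_\<xi>: "indep_vars (\<lambda>_. count_space (carrier (lamplighter_group q))) \<xi> {1..}"
    and law_\<xi>: "\<And>n g. n \<ge> 1 \<Longrightarrow> g \<in> carrier (lamplighter_group q) \<Longrightarrow>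
           prob {\<omega> \<in> space M. \<xi> n \<omega> = g} = step_law q p g"
begin

lemma indep_steps:
  "indep_vars (\<lambda>_. count_space (carrier (lamplighter_group q))) (\<lambda>i. \<xi> (Suc i)) UNIV"
proof -
  have "indep_vars (\<lambda>_. count_space (carrier (lamplighter_group q)))
      (\<lambda>j \<omega>. (\<lambda>s. s (Suc j)) (restrict (\<lambda>i. \<xi> i \<omega>) {Suc j})) UNIV"
    by (rule indep_vars_compose2[OF indep_vars_restrict[OF indep_\<xi>]])
      (auto simp: disjoint_family_on_def intro!: measurable_component_singleton)
  then show ?thesis by simp
qed

sublocale iid_group_walk M "lamplighter_group q" "\<lambda>i. \<xi> (Suc i)"
proof (intro iid_group_walk.intro iid_group_walk_axioms.intro)
  show "prob_space M" by unfold_locales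
  show "distr M (count_space (carrier (lamplighter_group q))) (\<xi> (Suc i)) =
      distr M (count_space (carrier (lamplighter_group q))) (\<xi> (Suc 0))" for i
  proof (rule measure_eqI_countable)
    fix g assume g: "g \<in> carrier (lamplighter_group q)"
    have rv: "\<xi> (Suc i) \<in> M \<rightarrow>\<^sub>M count_space (carrier (lamplighter_group q))" for i
      using indep_steps unfolding indep_vars_def by blast
    have "emeasure (distr M (count_space (carrier (lamplighter_group q))) (\<xi> (Suc i))) {g} =
        ennreal (step_law q p g)" for i
    proof -
      have "emeasure (distr M (count_space (carrier (lamplighter_group q))) (\<xi> (Suc i))) {g} =
          emeasure M (\<xi> (Suc i) -` {g} \<inter> space M)"
        using g by (intro emeasure_distr rv) auto
      also have "\<xi> (Suc i) -` {g} \<inter> space M = {\<omega>\<in>space M. \<xi> (Suc i) \<omega> = g}" by auto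
      finally show ?thesis using law_\<xi>[of "Suc i" g] g by (simp add: emeasure_eq_measure)
    qed
    then show "emeasure (distr M (count_space (carrier (lamplighter_group q))) (\<xi> (Suc i))) {g} =
        emeasure (distr M (count_space (carrier (lamplighter_group q))) (\<xi> (Suc 0))) {g}"
      by (simp only:)
  qed (auto simp: countable_lamplighter)
qed (auto simp: group_lamplighter_group countable_lamplighter indep_steps)

lemma random_walk_eq: "random_walk (lamplighter_group q) \<xi> n \<omega> = walk 0 n \<omega>"
  by (induction n) (auto simp: walk_def)

lemma AE_step_gen: "AE \<omega> in M. \<xi> (Suc n) \<omega> \<in> lamplighter_gens q"
proof -
  let ?E = "\<lambda>s. {\<omega>\<in>space M. \<xi> (Suc n) \<omega> = s}"
  have meas: "?E s \<in> events" if "s \<in> carrier (lamplighter_group q)" for s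
  proof -
    have "\<xi> (Suc n) -` {s} \<inter> space M \<in> events"
      using that by (intro measurable_sets[OF measurable_X]) auto
    also have "\<xi> (Suc n) -` {s} \<inter> space M = ?E s" by auto
    finally show ?thesis .
  qed
  have "prob (\<Union>s\<in>lamplighter_gens q. ?E s) = (\<Sum>s\<in>lamplighter_gens q. prob (?E s))"
    using meas lamplighter_gens_carrier finite_lamplighter_gens
    by (intro finite_measure_finite_Union) (auto simp: disjoint_family_on_def)
  also have "\<dots> = (\<Sum>s\<in>lamplighter_gens q. step_law q p s)"
    using lamplighter_gens_carrier by (intro sum.cong refl law_\<xi>) auto
  also have "\<dots> = 1"
    using q by (simp add: sum_lamplighter_gens step_law_switch step_law_move)
  finally have "AE \<omega> in M. \<omega> \<in> (\<Union>s\<in>lamplighter_gens q. ?E s)"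
    using meas lamplighter_gens_carrier finite_lamplighter_gens
    by (subst (asm) prob_eq_1) (auto intro!: sets.finite_UN)
  then show ?thesis by eventually_elim auto
qed

lemma expectation_step_lamplighter:
  assumes "\<And>g s. g \<in> carrier (lamplighter_group q) \<Longrightarrow> s \<in> lamplighter_gens q \<Longrightarrow> \<bar>f g s\<bar> \<le> (B :: real)"
  shows "expectation (\<lambda>\<omega>. f (walk 0 n \<omega>) (\<xi> (Suc n) \<omega>)) =
    p * expectation (\<lambda>\<omega>. f (walk 0 n \<omega>) switch_gen) +
    (1 - p) / real q * (\<Sum>a<q. expectation (\<lambda>\<omega>. f (walk 0 n \<omega>) (move_gen a)))"
proof -
  have "expectation (\<lambda>\<omega>. f (walk 0 n \<omega>) (\<xi> (Suc n) \<omega>)) =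
      (\<Sum>s\<in>lamplighter_gens q. prob {\<omega>\<in>space M. \<xi> (Suc n) \<omega> = s} * expectation (\<lambda>\<omega>. f (walk 0 n \<omega>) s))"
    by (rule expectation_step[OF finite_lamplighter_gens lamplighter_gens_carrier AE_step_gen assms])
  also have "\<dots> = (\<Sum>s\<in>lamplighter_gens q. step_law q p s * expectation (\<lambda>\<omega>. f (walk 0 n \<omega>) s))"
    using lamplighter_gens_carrier by (intro sum.cong refl arg_cong2[where f = "(*)"] law_\<xi>) auto
  also have "\<dots> = p * expectation (\<lambda>\<omega>. f (walk 0 n \<omega>) switch_gen) +
    (1 - p) / real q * (\<Sum>a<q. expectation (\<lambda>\<omega>. f (walk 0 n \<omega>) (move_gen a)))"
    by (simp add: sum_lamplighter_gens step_law_switch step_law_move sum_distrib_left)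
  finally show ?thesis .
qed

sublocale lamp: subadditive_walk M "lamplighter_group q" "\<lambda>i. \<xi> (Suc i)" "\<lambda>g. real (lamplighter_length q g)"
proof
  show "AE \<omega> in M. real (lamplighter_length q (\<xi> (Suc i) \<omega>)) \<le> 1" for i
    using AE_step_gen[of i]
  proof eventually_elim
    case (elim \<omega>)
    from lamplighter_length_gen[OF this] show ?case by linarith
  qed
  show "real (lamplighter_length q (g \<otimes>\<^bsub>lamplighter_group q\<^esub> h)) \<le>
      real (lamplighter_length q g) + real (lamplighter_length q h)"
    if "g \<in> carrier (lamplighter_group q)" "h \<in> carrier (lamplighter_group q)" for g h
    using lamplighter_length_mult[OF that] by linarith
qed (auto simp: lamplighter_length_one)

sublocale tree: subadditive_walk M "lamplighter_group q" "\<lambda>i. \<xi> (Suc i)" "\<lambda>g. real (length (snd g))"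
proof
  show "AE \<omega> in M. real (length (snd (\<xi> (Suc i) \<omega>))) \<le> 1" for i
    using AE_step_gen[of i]
    by eventually_elim (auto simp: lamplighter_gens_def switch_gen_def move_gen_def)
  show "real (length (snd (g \<otimes>\<^bsub>lamplighter_group q\<^esub> h))) \<le> real (length (snd g)) + real (length (snd h))" for g h
    using length_tree_mult[of "snd g" "snd h"] by simp
qed (auto simp: lamplighter_one)

section \<open>The mean sign of a lamp near the walker\<close>

text \<open>
  The lamps are indexed by their position \<open>w\<close> relative to the walker. In this way the last step of
  the walk acts on \<open>w\<close> alone, and the recursion below needs no reversal of time.
\<close>

definition lamp_sign_mean :: "nat \<Rightarrow> word \<Rightarrow> real" where
  "lamp_sign_mean n w = expectation (\<lambda>\<omega>. bit_sign
     (fst (walk 0 n \<omega>) (snd (walk 0 n \<omega>) \<otimes>\<^bsub>tree_group q\<^esub> w)))"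

lemma lamp_sign_mean_0: "lamp_sign_mean 0 w = 1"
  by (simp add: lamp_sign_mean_def walk_def lamplighter_one bit_sign_def prob_space)

text \<open>
  If the last step is a switch, then it reverses the sign of the lamp at relative position \<open>[]\<close> and
  no other. If it is a move along the letter \<open>a\<close>, then the lamp at relative position \<open>w\<close> was at
  relative position \<open>a w\<close> before.
\<close>

lemma lamp_sign_mean_Suc:
  assumes w: "w \<in> carrier (tree_group q)"
  shows "lamp_sign_mean (Suc n) w = (if w = [] then - p else p) * lamp_sign_mean n w +
    (1 - p) / real q * (\<Sum>a<q. lamp_sign_mean n (push_letter a w))"
proof -
  let ?G = "lamplighter_group q" and ?T = "tree_group q"
  interpret T: group ?T by (rule group_tree_group)
  let ?s = "\<lambda>g. bit_sign (fst g (snd g \<otimes>\<^bsub>?T\<^esub> w))"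
  have "lamp_sign_mean (Suc n) w = expectation (\<lambda>\<omega>. ?s (walk 0 n \<omega> \<otimes>\<^bsub>?G\<^esub> \<xi> (Suc n) \<omega>))"
    by (simp add: lamp_sign_mean_def walk_def)
  also have "\<dots> = p * expectation (\<lambda>\<omega>. ?s (walk 0 n \<omega> \<otimes>\<^bsub>?G\<^esub> switch_gen)) +
      (1 - p) / real q * (\<Sum>a<q. expectation (\<lambda>\<omega>. ?s (walk 0 n \<omega> \<otimes>\<^bsub>?G\<^esub> move_gen a)))"
    by (rule expectation_step_lamplighter[where B = 1]) simp
  also have "expectation (\<lambda>\<omega>. ?s (walk 0 n \<omega> \<otimes>\<^bsub>?G\<^esub> switch_gen)) =
      expectation (\<lambda>\<omega>. (if w = [] then -1 else 1) * ?s (walk 0 n \<omega>))"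
  proof (rule Bochner_Integration.integral_cong[OF refl])
    fix \<omega> assume "\<omega> \<in> space M"
    then obtain \<eta> x where g: "walk 0 n \<omega> = (\<eta>, x)" and x: "x \<in> carrier ?T"
      using walk_closed[of \<omega> 0 n] by (cases "walk 0 n \<omega>") (auto simp: lamplighter_carrier_iff)
    have "x \<otimes>\<^bsub>?T\<^esub> w = x \<longleftrightarrow> w = \<one>\<^bsub>?T\<^esub>"
      using x w by (metis T.l_cancel_one')
    then show "?s (walk 0 n \<omega> \<otimes>\<^bsub>?G\<^esub> switch_gen) = (if w = [] then -1 else 1) * ?s (walk 0 n \<omega>)"
      using x by (simp add: g mult_switch bit_sign_add_1 del: add_bit_eq_xor)
  qed
  also have "\<dots> = (if w = [] then -1 else 1) * lamp_sign_mean n w"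
    by (simp add: lamp_sign_mean_def)
  also have "(\<Sum>a<q. expectation (\<lambda>\<omega>. ?s (walk 0 n \<omega> \<otimes>\<^bsub>?G\<^esub> move_gen a))) =
      (\<Sum>a<q. lamp_sign_mean n (push_letter a w))"
  proof (intro sum.cong refl)
    fix a assume a: "a \<in> {..<q}"
    show "expectation (\<lambda>\<omega>. ?s (walk 0 n \<omega> \<otimes>\<^bsub>?G\<^esub> move_gen a)) = lamp_sign_mean n (push_letter a w)"
      unfolding lamp_sign_mean_def
    proof (rule Bochner_Integration.integral_cong[OF refl])
      fix \<omega> assume "\<omega> \<in> space M"
      then obtain \<eta> x where g: "walk 0 n \<omega> = (\<eta>, x)" and x: "x \<in> carrier ?T"
        using walk_closed[of \<omega> 0 n] by (cases "walk 0 n \<omega>") (auto simp: lamplighter_carrier_iff)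
      have "(x \<otimes>\<^bsub>?T\<^esub> [a]) \<otimes>\<^bsub>?T\<^esub> w = x \<otimes>\<^bsub>?T\<^esub> push_letter a w"
        using T.m_assoc[of x "[a]" w] x w a by simp
      then show "?s (walk 0 n \<omega> \<otimes>\<^bsub>?G\<^esub> move_gen a) =
          bit_sign (fst (walk 0 n \<omega>) (snd (walk 0 n \<omega>) \<otimes>\<^bsub>?T\<^esub> push_letter a w))"
        by (simp add: g move_gen_def mult_move)
    qed
  qed
  finally show ?thesis by simp
qed

text \<open>
  Exactly one letter shortens a nonempty word, and the other \<open>q - 1\<close> letters lengthen it.
\<close>

lemma sum_push_letter:
  fixes F :: "nat \<Rightarrow> real"
  assumes "w \<in> carrier (tree_group q)"
  shows "(\<Sum>a<q. F (length (push_letter a w))) =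
    (if w = [] then real q * F 1 else F (length w - 1) + (real q - 1) * F (length w + 1))"
proof (cases w)
  case (Cons b v)
  then have b: "b < q" using assms by (simp add: tree_carrier_iff)
  have "(\<Sum>a<q. F (length (push_letter a w))) = (\<Sum>a<q. if a = b then F (length v) else F (length v + 2))"
    by (intro sum.cong) (auto simp: Cons)
  also have "\<dots> = F (length v) + (\<Sum>a\<in>{..<q} - {b}. F (length v + 2))"
    using b by (subst sum.remove[of _ b]) auto
  also have "(\<Sum>a\<in>{..<q} - {b}. F (length v + 2)) = (real q - 1) * F (length v + 2)"
    using b by (simp add: of_nat_diff)
  finally show ?thesis by (simp add: Cons)
qed simp

text \<open>
  The constant \<open>c\<close> for which \<open>limit_profile\<close> solves the fixed point equation at the root.
\<close>

definition limit_defect :: real where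
  "limit_defect = 2 * p / ((1 + p) - (1 - p) / (real q - 1))"

text \<open>
  The factor by which the walk on the tree contracts \<open>(2/3)^{|w|}\<close> away from the root. The function
  \<open>s^{|w|}\<close> is contracted there whenever \<open>1 / (q - 1) < s < 1\<close>, and \<open>s = 2 / 3\<close> lies in this range
  for all \<open>q \<ge> 3\<close>.
\<close>

definition decay :: real where
  "decay = p + (1 - p) / real q * (3 / 2 + 2 / 3 * (real q - 1))"

lemma limit_defect: "0 < limit_defect" "limit_defect < 1"
proof -
  have "(1 - p) / (real q - 1) < 1 - p"
    using p q by (simp add: divide_less_eq)
  then have less: "2 * p < (1 + p) - (1 - p) / (real q - 1)" by simp
  then have pos: "0 < (1 + p) - (1 - p) / (real q - 1)" using p by linarith
  show "0 < limit_defect"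
    unfolding limit_defect_def by (rule divide_pos_pos[OF _ pos]) (use p in simp)
  show "limit_defect < 1"
    using less unfolding limit_defect_def by (simp only: divide_less_eq_1_pos[OF pos])
qed

lemma decay: "0 < decay" "decay < 1"
proof -
  have "3 / 2 + 2 / 3 * (real q - 1) < real q"
    using q by (simp add: field_simps)
  then have "(3 / 2 + 2 / 3 * (real q - 1)) / real q < 1"
    using q by (simp add: divide_less_eq)
  then have "(1 - p) * ((3 / 2 + 2 / 3 * (real q - 1)) / real q) < (1 - p) * 1"
    using p by (intro mult_strict_left_mono) auto
  then show "decay < 1" by (simp add: decay_def)
  show "0 < decay"
    using p q unfolding decay_def by (intro add_pos_nonneg mult_nonneg_nonneg) auto
qed

text \<open>
  Away from the root the recursion is averaging over the walk, for which \<open>(q - 1)^{-|w|}\<close> is harmonic: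
  it is the probability that the walk on the tree ever reaches the root from \<open>w\<close>.
\<close>

definition limit_profile :: "nat \<Rightarrow> real" where
  "limit_profile k = 1 - limit_defect * (1 / (real q - 1)) ^ k"

lemma limit_profile_fixed:
  assumes w: "w \<in> carrier (tree_group q)"
  shows "limit_profile (length w) = (if w = [] then - p else p) * limit_profile (length w) +
    (1 - p) / real q * (\<Sum>a<q. limit_profile (length (push_letter a w)))"
proof (cases w)
  case Nil
  have nz: "(1 + p) - (1 - p) / (real q - 1) \<noteq> 0"
    using limit_defect p unfolding limit_defect_def by auto
  then have "limit_defect * ((1 + p) - (1 - p) / (real q - 1)) = 2 * p"
    by (simp add: limit_defect_def)
  moreover have "(1 - p) / real q * (real q * limit_profile 1) = (1 - p) * limit_profile 1"
    using q by simp
  ultimately show ?thesis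
    unfolding sum_push_letter[OF w] using Nil
    by (simp add: limit_profile_def algebra_simps)
next
  case (Cons b v)
  let ?r = "1 / (real q - 1)"
  have "(real q - 1) * ?r = 1" using q by simp
  then have "R + (real q - 1) * (?r * (?r * R)) = real q * (?r * R)" for R
    by algebra
  from this[of "?r ^ length v"]
  have "?r ^ length v + (real q - 1) * ?r ^ (length v + 2) = real q * ?r ^ (length v + 1)"
    by simp
  moreover have "1 - d * A + (Q - 1) * (1 - d * B) = Q * (1 - d * C)"
    if "A + (Q - 1) * B = Q * C" for d A B C Q :: real
  proof -
    have "1 - d * A + (Q - 1) * (1 - d * B) = Q - d * (A + (Q - 1) * B)"
      by (simp add: algebra_simps)
    also have "\<dots> = Q * (1 - d * C)"
      unfolding that by (simp add: algebra_simps)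
    finally show ?thesis .
  qed
  ultimately have "limit_profile (length v) + (real q - 1) * limit_profile (length v + 2) =
      real q * limit_profile (length v + 1)"
    unfolding limit_profile_def by blast
  then show ?thesis
    unfolding sum_push_letter[OF w] using Cons q by (simp add: field_simps)
qed

text \<open>
  The difference of two solutions of a linear recursion is again a solution, and the reversed sign
  at the root is harmless after taking absolute values. So the difference is dominated by the
  iterates of the transition operator applied to \<open>(2/3)^{|w|}\<close>.
\<close>

lemma lamp_sign_mean_approx:
  assumes "w \<in> carrier (tree_group q)"
  shows "\<bar>lamp_sign_mean n w - limit_profile (length w)\<bar> \<le> decay ^ n * (2 / 3) ^ length w"
  using assms
proof (induction n arbitrary: w)
  case 0
  have r: "1 / (real q - 1) \<le> 2 / 3" "0 \<le> 1 / (real q - 1)"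
    using q by (simp_all add: divide_le_eq)
  have "limit_defect * (1 / (real q - 1)) ^ length w \<le> 1 * (2 / 3) ^ length w"
    using limit_defect r by (intro mult_mono power_mono) auto
  moreover have "0 \<le> limit_defect * (1 / (real q - 1)) ^ length w"
    using limit_defect r by simp
  ultimately show ?case
    by (simp add: lamp_sign_mean_0 limit_profile_def)
next
  case (Suc n)
  let ?D = "\<lambda>w. lamp_sign_mean n w - limit_profile (length w)"
  let ?s = "\<lambda>k. (2 / 3 :: real) ^ k"
  have push: "push_letter a w \<in> carrier (tree_group q)" if "a < q" for a
    using that Suc.prems by (rule push_letter_carrier)
  have "lamp_sign_mean (Suc n) w - limit_profile (length w) =
      (if w = [] then - p else p) * ?D w + (1 - p) / real q * (\<Sum>a<q. ?D (push_letter a w))"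
    by (subst lamp_sign_mean_Suc[OF Suc.prems], subst limit_profile_fixed[OF Suc.prems])
      (simp add: sum_subtractf algebra_simps)
  also have "\<bar>\<dots>\<bar> \<le> p * \<bar>?D w\<bar> + (1 - p) / real q * (\<Sum>a<q. \<bar>?D (push_letter a w)\<bar>)"
    using p q by (intro order.trans[OF abs_triangle_ineq] add_mono)
      (auto simp: abs_mult intro!: mult_left_mono divide_right_mono)
  also have "\<dots> \<le> p * (decay ^ n * ?s (length w)) +
      (1 - p) / real q * (\<Sum>a<q. decay ^ n * ?s (length (push_letter a w)))"
    using p q Suc.IH[OF Suc.prems] Suc.IH[OF push]
    by (intro add_mono mult_left_mono sum_mono) auto
  also have "\<dots> = decay ^ n * (p * ?s (length w) +
      (1 - p) / real q * (\<Sum>a<q. ?s (length (push_letter a w))))"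
    by (simp add: sum_distrib_left algebra_simps)
  also have "\<dots> \<le> decay ^ n * (decay * ?s (length w))"
  proof (intro mult_left_mono)
    define K where "K = 3 / 2 + 2 / 3 * (real q - 1)"
    have "(\<Sum>a<q. ?s (length (push_letter a w))) \<le> K * ?s (length w)"
      unfolding K_def sum_push_letter[OF Suc.prems] by (cases w) (auto simp: field_simps)
    then have "(1 - p) / real q * (\<Sum>a<q. ?s (length (push_letter a w))) \<le>
        (1 - p) / real q * (K * ?s (length w))"
      using p by (intro mult_left_mono) auto
    then show "p * ?s (length w) + (1 - p) / real q * (\<Sum>a<q. ?s (length (push_letter a w)))
        \<le> decay * ?s (length w)"
      unfolding decay_def K_def[symmetric] distrib_right mult.assoc by (rule add_left_mono)
  qed (use decay in auto)
  finally show ?case by (simp add: mult_ac)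
qed

section \<open>Linear growth of the number of lit lamps\<close>

lemma AE_lengths:
  "AE \<omega> in M. \<forall>n. length (snd (walk 0 n \<omega>)) + lamps_on (walk 0 n \<omega>) \<le> lamplighter_length q (walk 0 n \<omega>) \<and>
     lamplighter_length q (walk 0 n \<omega>) \<le> n"
  using lamp.AE_L_walk_le
  by (rule AE_mp) (auto intro!: AE_I2 lamplighter_length_ge walk_closed)

lemma measurable_lamps_on[measurable]: "(\<lambda>\<omega>. real (lamps_on (walk 0 n \<omega>))) \<in> borel_measurable M"
  by (rule measurable_compose[OF measurable_walk]) auto

lemma integrable_lamps_on: "integrable M (\<lambda>\<omega>. real (lamps_on (walk 0 n \<omega>)))"
proof (rule integrable_const_bound)
  show "AE \<omega> in M. norm (real (lamps_on (walk 0 n \<omega>))) \<le> real n"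
    using AE_lengths
  proof eventually_elim
    case (elim \<omega>)
    from elim[rule_format, of n] show ?case by simp
  qed
qed measurable

lemma expectation_lamps_on_Suc:
  "expectation (\<lambda>\<omega>. real (lamps_on (walk 0 (Suc n) \<omega>))) =
   expectation (\<lambda>\<omega>. real (lamps_on (walk 0 n \<omega>))) + p * lamp_sign_mean n []"
proof -
  let ?G = "lamplighter_group q"
  let ?f = "\<lambda>g s. real (lamps_on (g \<otimes>\<^bsub>?G\<^esub> s)) - real (lamps_on g)"
  have Suc: "walk 0 (Suc n) \<omega> = walk 0 n \<omega> \<otimes>\<^bsub>?G\<^esub> \<xi> (Suc n) \<omega>" for \<omega>
    by (simp add: walk_def)
  have "expectation (\<lambda>\<omega>. real (lamps_on (walk 0 (Suc n) \<omega>))) -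
      expectation (\<lambda>\<omega>. real (lamps_on (walk 0 n \<omega>))) =
      expectation (\<lambda>\<omega>. ?f (walk 0 n \<omega>) (\<xi> (Suc n) \<omega>))"
    unfolding Suc[symmetric]
    by (rule Bochner_Integration.integral_diff[symmetric]) (rule integrable_lamps_on)+
  also have "\<dots> = p * expectation (\<lambda>\<omega>. ?f (walk 0 n \<omega>) switch_gen) +
      (1 - p) / real q * (\<Sum>a<q. expectation (\<lambda>\<omega>. ?f (walk 0 n \<omega>) (move_gen a)))"
    by (rule expectation_step_lamplighter[where B = 1])
      (auto simp: lamplighter_gens_def lamps_on_switch lamps_on_move)
  also have "\<dots> = p * expectation (\<lambda>\<omega>. ?f (walk 0 n \<omega>) switch_gen)"
    by (simp add: lamps_on_move)
  also have "expectation (\<lambda>\<omega>. ?f (walk 0 n \<omega>) switch_gen) = lamp_sign_mean n []"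
    unfolding lamp_sign_mean_def
  proof (rule Bochner_Integration.integral_cong[OF refl])
    interpret T: group "tree_group q" by (rule group_tree_group)
    fix \<omega> assume "\<omega> \<in> space M"
    then have g: "walk 0 n \<omega> \<in> carrier ?G" by (rule walk_closed)
    then have "snd (walk 0 n \<omega>) \<otimes>\<^bsub>tree_group q\<^esub> \<one>\<^bsub>tree_group q\<^esub> = snd (walk 0 n \<omega>)"
      by (intro T.r_one) (simp add: lamplighter_carrier_iff)
    then show "?f (walk 0 n \<omega>) switch_gen =
        bit_sign (fst (walk 0 n \<omega>) (snd (walk 0 n \<omega>) \<otimes>\<^bsub>tree_group q\<^esub> []))"
      using g by (simp add: lamps_on_switch)
  qed
  finally show ?thesis by simp
qed

lemma expectation_lamps_on_ge:
  "p * (real n * (1 - limit_defect) - 1 / (1 - decay)) \<le> expectation (\<lambda>\<omega>. real (lamps_on (walk 0 n \<omega>)))"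
proof -
  have "expectation (\<lambda>\<omega>. real (lamps_on (walk 0 n \<omega>))) = (\<Sum>k<n. p * lamp_sign_mean k [])"
  proof (induction n)
    case 0
    show ?case by (simp add: walk_def lamplighter_one lamps_on_def)
  qed (simp add: expectation_lamps_on_Suc)
  moreover have "(\<Sum>k<n. p * ((1 - limit_defect) - decay ^ k)) \<le> (\<Sum>k<n. p * lamp_sign_mean k [])"
  proof (intro sum_mono mult_left_mono)
    fix k
    show "(1 - limit_defect) - decay ^ k \<le> lamp_sign_mean k []"
      using lamp_sign_mean_approx[of "[]" k] by (simp add: limit_profile_def abs_le_iff)
  qed (use p in auto)
  moreover have "(\<Sum>k<n. decay ^ k) \<le> 1 / (1 - decay)"
    using decay sum_le_suminf[OF summable_geometric, of decay "{..<n}"]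
    by (simp add: suminf_geometric)
  then have "p * (real n * (1 - limit_defect) - 1 / (1 - decay)) \<le> (\<Sum>k<n. p * ((1 - limit_defect) - decay ^ k))"
    using p by (simp add: sum_distrib_left[symmetric] sum_subtractf)
  ultimately show ?thesis by simp
qed

text \<open>
  The normalised lengths are bounded, so the almost sure limits are limits of expectations, which the
  expected number of lit lamps separates.
\<close>

lemma rates_differ:
  assumes l: "AE \<omega> in M. (\<lambda>n. real (lamplighter_length q (walk 0 n \<omega>)) / real n) \<longlonglongrightarrow> l"
    and v: "AE \<omega> in M. (\<lambda>n. real (length (snd (walk 0 n \<omega>))) / real n) \<longlonglongrightarrow> v"
  shows "p * (1 - limit_defect) \<le> l - v"
proof -
  let ?d = "\<lambda>n \<omega>. real (lamplighter_length q (walk 0 n \<omega>)) / real n - real (length (snd (walk 0 n \<omega>))) / real n"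
  have bounds: "AE \<omega> in M. real (lamps_on (walk 0 n \<omega>)) / real n \<le> ?d n \<omega> \<and> norm (?d n \<omega>) \<le> 1" for n
    using AE_lengths
  proof eventually_elim
    case (elim \<omega>)
    from elim[rule_format, of n] show ?case
      by (cases "n = 0") (auto simp: diff_divide_distrib[symmetric] divide_le_eq intro!: divide_right_mono)
  qed
  have int: "integrable M (?d n)" for n
    by (rule integrable_const_bound[where B = 1]) (use bounds[of n] in auto)
  have "(\<lambda>n. expectation (?d n)) \<longlonglongrightarrow> expectation (\<lambda>_. l - v)"
  proof (rule integral_dominated_convergence[where w = "\<lambda>_. 1"])
    show "AE \<omega> in M. (\<lambda>n. ?d n \<omega>) \<longlonglongrightarrow> l - v"
      using l v by eventually_elim (rule tendsto_diff)
    show "AE \<omega> in M. norm (?d n \<omega>) \<le> 1" for n using bounds[of n] by auto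
  qed auto
  then have lim: "(\<lambda>n. expectation (?d n)) \<longlonglongrightarrow> l - v" by (simp add: prob_space)
  have "(\<lambda>n. p * (1 - limit_defect) - (p / (1 - decay)) / real n) \<longlonglongrightarrow> p * (1 - limit_defect) - 0"
    by (intro tendsto_diff tendsto_const lim_const_over_n)
  from LIMSEQ_le[OF this lim] show ?thesis
  proof (simp, elim meta_mp, intro exI[of _ 1] allI impI)
    fix n :: nat assume n: "1 \<le> n"
    have "p * (1 - limit_defect) - p / (1 - decay) / real n =
        p * (real n * (1 - limit_defect) - 1 / (1 - decay)) / real n"
      using n by (simp add: right_diff_distrib diff_divide_distrib)
    also have "\<dots> \<le> expectation (\<lambda>\<omega>. real (lamps_on (walk 0 n \<omega>))) / real n"
      by (intro divide_right_mono expectation_lamps_on_ge) auto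
    also have "\<dots> = expectation (\<lambda>\<omega>. real (lamps_on (walk 0 n \<omega>)) / real n)"
      by simp
    also have "\<dots> \<le> expectation (?d n)"
      using bounds[of n] int integrable_lamps_on by (intro integral_mono_AE) auto
    finally show "p * (1 - limit_defect) - p / ((1 - decay) * real n) \<le> expectation (?d n)" by simp
  qed
qed

end

theorem mainTheorem3:
  fixes q :: nat and p :: real
    and M :: "'w measure" and \<xi> :: "nat \<Rightarrow> 'w \<Rightarrow> config \<times> word"
  assumes "q \<ge> 3" and "0 < p" and "p < 1"
    and "prob_space M"
    and "prob_space.indep_vars M (\<lambda>_. count_space (carrier (lamplighter_group q))) \<xi> {1..}"
    and "\<And>n g. n \<ge> 1 \<Longrightarrow> g \<in> carrier (lamplighter_group q) \<Longrightarrow>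
           measure M {\<omega> \<in> space M. \<xi> n \<omega> = g} = step_law q p g"
  shows "\<exists>l v :: real.
     (AE \<omega> in M. (\<lambda>n. real (lamplighter_length q (random_walk (lamplighter_group q) \<xi> n \<omega>)) / real n)
        \<longlonglongrightarrow> l) \<and>
     (AE \<omega> in M. (\<lambda>n. real (tree_length q (snd (random_walk (lamplighter_group q) \<xi> n \<omega>))) / real n)
        \<longlonglongrightarrow> v) \<and>
     l > v"
proof -
  interpret prob_space M by fact
  interpret lamplighter_walk M q p \<xi>
    by unfold_locales (use assms in auto)
  obtain l where l: "AE \<omega> in M. (\<lambda>n. real (lamplighter_length q (walk 0 n \<omega>)) / real n) \<longlonglongrightarrow> l"
    using lamp.rate_exists by blast
  obtain v where v: "AE \<omega> in M. (\<lambda>n. real (length (snd (walk 0 n \<omega>))) / real n) \<longlonglongrightarrow> v"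
    using tree.rate_exists by blast
  have "0 < p * (1 - limit_defect)"
    using p limit_defect by simp
  then have "v < l" using rates_differ[OF l v] by simp
  moreover have "AE \<omega> in M. (\<lambda>n. real (tree_length q (snd (walk 0 n \<omega>))) / real n) \<longlonglongrightarrow> v"
    using v
  proof (rule AE_mp, intro AE_I2 impI)
    fix \<omega> assume "\<omega> \<in> space M"
    then have "tree_length q (snd (walk 0 n \<omega>)) = length (snd (walk 0 n \<omega>))" for n
      using walk_closed[of \<omega> 0 n] by (intro tree_length_eq) (simp add: lamplighter_carrier_iff)
    then show "(\<lambda>n. real (length (snd (walk 0 n \<omega>))) / real n) \<longlonglongrightarrow> v \<Longrightarrow>
        (\<lambda>n. real (tree_length q (snd (walk 0 n \<omega>))) / real n) \<longlonglongrightarrow> v" by simp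
  qed
  ultimately show ?thesis
    using l unfolding random_walk_eq by blast
qed

end
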